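(* Let $\mathbb X$ be $\mathbb S^d$, $\mathbb R^d$, or $\mathbb H^d$, let $a\in\mathbb X$, and let $f(x)=[1-d(x,a)]^+$ for $x\in\mathbb X$. (a) If $d(a,o)\le 1$, then for every $n\ge1$ $$E\bigl(\|S_{W_1\dots W_n}f-f^*\|_\infty\bigr)\ge\|f-f^*\|_\infty\,2^{-n}$$ for every sequence $\{W_i\}_{i\ge1}$ of independent random variables on $\Omega$ such that the distribution of each $W_i=(R_i,U_i)$ is symmetric under $U_i\mapsto-U_i$. (b) If $a\ne o$, then there exists a dense sequence $\{\omega_i\}_{i\ge1}$ in $\Omega$ such that $S_{\omega_1\dots\omega_n}f$ has no limit in $\mathcal C_c^+(\mathbb X)$ (in the topology of uniform convergence) as $n\to\infty$.
   Context: $[t]^+=\max\{t,0\}$. $\mathbb X$ is the sphere $\mathbb S^d$, Euclidean space $\mathbb R^d$, or standard hyperbolic space $\mathbb H^d$, with its uniform Riemannian distance $d(x,y)$, Riemannian volume $m$, and a distinguished point $o\in\mathbb X$ (the origin). $\mathcal C_c^+(\mathbb X)$ is the space of nonnegative continuous compactly supported functions on $\mathbb X$. For $A\subset\mathbb X$ of finite volume, $A^*$ is the open ball centered at $o$ with $m(A^* )=m(A)$; $f^*$ is the lower semicontinuous radially decreasing function with $\{f^*>t\}=\{f>t\}^*$ for all $t>0$ (symmetric decreasing rearrangement). A reflection of $\mathbb X$ is an isometry $\sigma$ with $\sigma^2=I$ exchanging two complementary half-spaces such that $d(x,\sigma y)\ge d(x,y)$ whenever $x,y$ lie in the same half-space.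 For distinct $x,y$ there is a unique reflection mapping $x$ to $y$. Fix normal (geodesic polar) coordinates $x=(r,u)$ centered at $o$, with $r=d(x,o)$, $u\in\mathbb S^{d-1}$, and let $\Omega=[0,\infty)\times\mathbb S^{d-1}$ be the parameter space (for $\mathbb X=\mathbb S^d$ only parameters with $r\le\pi$ are used, and density in $\Omega$ means density in $[0,\pi]\times\mathbb S^{d-1}$). For $\omega=(r,u)$ with $r>0$, $\sigma_\omega$ is the reflection mapping $o$ to the point with normal coordinates $(r,u)$. Writing $\bar x=\sigma_\omega x$, $H^+=\{x:d(x,o)\le d(\bar x,o)\}$, $H^-=\{x:d(x,o)\ge d(\bar x,o)\}$, the polarization is $S_\omega f(x)=\max\{f(x),f(\bar x)\}$ for $x\in H^+$ and $S_\omega f(x)=\min\{f(x),f(\bar x)\}$ for $x\in H^-$. Set $S_{\omega_1\dots\omega_n}=S_{\omega_n}\circ\dots\circ S_{\omega_1}$; in any such sequence of polarizations all $\omega_i=(r_i,u_i)$ have $r_i>0$. Random variables $W=(R,U)$ on $\Omega$ have a Borel probability distribution $\mu$ with $\mu(R=0)=0$ and, if $\mathbb X=\mathbb S^d$, $\mu(R>\pi)=0$. *)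

theory Defs
  imports "HOL-Probability.Probability"
begin

text \<open>
  The three spaces are realised inside \<open>real \<times> 'v\<close>, where \<open>'v\<close> is a Euclidean space of
  dimension \<open>d\<close> (it plays the role of the tangent space at the origin): the sphere as the unit
  sphere, Euclidean space as the affine hyperplane \<open>{1} \<times> 'v\<close>, and hyperbolic space as the
  upper sheet of the hyperboloid \<open>t\<^sup>2 - \<bar>v\<bar>\<^sup>2 = 1\<close>. In all three models the origin \<open>o\<close> is \<open>(1, 0)\<close>.
\<close>

datatype geometry = Spherical | Euclidean | Hyperbolic

fun model :: "geometry \<Rightarrow> (real \<times> 'v::euclidean_space) set" where
  "model Spherical = {x. norm x = 1}"
| "model Euclidean = {x. fst x = 1}"
| "model Hyperbolic = {x. fst x > 0 \<and> (fst x)\<^sup>2 - snd x \<bullet> snd x = 1}"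

fun gdist :: "geometry \<Rightarrow> real \<times> 'v::euclidean_space \<Rightarrow> real \<times> 'v \<Rightarrow> real" where
  "gdist Spherical x y = arccos (x \<bullet> y)"
| "gdist Euclidean x y = dist x y"
| "gdist Hyperbolic x y = arcosh (fst x * fst y - snd x \<bullet> snd y)"

definition origin :: "real \<times> 'v::euclidean_space" where
  "origin = (1, 0)"

definition gball :: "geometry \<Rightarrow> real \<times> 'v::euclidean_space \<Rightarrow> real \<Rightarrow> (real \<times> 'v) set" where
  "gball X c \<rho> = {x \<in> model X. gdist X x c < \<rho>}"

text \<open>
  Riemannian volume of a subset of one of the models, in the chart \<open>(t, v) \<mapsto> v\<close>. Each model
  consists of graphs \<open>t = t(v)\<close>, and its metric tensor is \<open>\<delta>\<^sub>i\<^sub>j + \<epsilon> \<partial>\<^sub>i t \<partial>\<^sub>j t\<close> with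
  \<open>\<epsilon> = 1\<close> for the sphere (\<open>t = \<plusminus>sqrt (1 - \<bar>v\<bar>\<^sup>2)\<close>) and for Euclidean space (\<open>t = 1\<close>),
  \<open>\<epsilon> = -1\<close> for hyperbolic space (\<open>t = sqrt (1 + \<bar>v\<bar>\<^sup>2)\<close>). In each case the volume density
  \<open>sqrt (det g) = sqrt (1 + \<epsilon> \<bar>\<nabla>t\<bar>\<^sup>2)\<close> equals \<open>1 / \<bar>t\<bar>\<close>. The sum over \<open>t\<close> collects the two
  hemispheres of the sphere (their common boundary \<open>t = 0\<close> has volume zero); for the other two
  models it has at most one term.
\<close>

definition gvolume :: "(real \<times> 'v::euclidean_space) set \<Rightarrow> ennreal" where
  "gvolume A = (\<integral>\<^sup>+ v. (\<Sum>t \<in> {t. (t, v) \<in> A}. ennreal (1 / \<bar>t\<bar>)) \<partial>lborel)"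

text \<open>
  \<open>A\<^sup>*\<close> is the open ball about the origin with the volume of \<open>A\<close>. That ball is unique as a set,
  so the union below has just one member, except when \<open>A\<close> has the volume of the whole sphere:
  then both the sphere and the sphere minus the antipode of the origin qualify, and \<open>A\<^sup>*\<close> is
  the whole sphere.
\<close>

definition ball_rearr :: "geometry \<Rightarrow> (real \<times> 'v::euclidean_space) set \<Rightarrow> (real \<times> 'v) set" where
  "ball_rearr X A = \<Union>{B. \<exists>\<rho>\<ge>0. B = gball X origin \<rho> \<and> gvolume B = gvolume A}"

definition is_sym_decr_rearr ::
  "geometry \<Rightarrow> (real \<times> 'v::euclidean_space \<Rightarrow> real) \<Rightarrow> (real \<times> 'v \<Rightarrow> real) \<Rightarrow> bool" where
  "is_sym_decr_rearr X f g \<longleftrightarrow>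
     (\<forall>x\<in>model X. 0 \<le> g x) \<and>
     (\<forall>s. openin (top_of_set (model X)) {x \<in> model X. g x > s}) \<and>
     (\<forall>x\<in>model X. \<forall>y\<in>model X. gdist X x origin \<le> gdist X y origin \<longrightarrow> g y \<le> g x) \<and>
     (\<forall>t>0. {x \<in> model X. g x > t} = ball_rearr X {x \<in> model X. f x > t})"

text \<open>The superlevel sets determine \<open>f\<^sup>*\<close> on the model; values elsewhere are irrelevant.\<close>

definition sym_decr_rearr ::
  "geometry \<Rightarrow> (real \<times> 'v::euclidean_space \<Rightarrow> real) \<Rightarrow> real \<times> 'v \<Rightarrow> real" where
  "sym_decr_rearr X f = (SOME g. is_sym_decr_rearr X f g)"

text \<open>
  In all three geometries the half-spaces are the sets of points at least as close to \<open>p\<close> as to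
  \<open>q\<close>, for distinct points \<open>p\<close> and \<open>q\<close>; exchanging \<open>p\<close> and \<open>q\<close> gives the complementary half-space.
\<close>

definition half_space ::
  "geometry \<Rightarrow> real \<times> 'v::euclidean_space \<Rightarrow> real \<times> 'v \<Rightarrow> (real \<times> 'v) set" where
  "half_space X p q = {x \<in> model X. gdist X x p \<le> gdist X x q}"

definition is_reflection ::
  "geometry \<Rightarrow> (real \<times> 'v::euclidean_space \<Rightarrow> real \<times> 'v) \<Rightarrow> bool" where
  "is_reflection X \<sigma> \<longleftrightarrow>
     \<sigma> ` model X = model X \<and>
     (\<forall>x\<in>model X. \<forall>y\<in>model X. gdist X (\<sigma> x) (\<sigma> y) = gdist X x y) \<and>
     (\<forall>x\<in>model X. \<sigma> (\<sigma> x) = x) \<and>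
     (\<exists>p\<in>model X. \<exists>q\<in>model X. p \<noteq> q \<and>
        \<sigma> ` half_space X p q = half_space X q p \<and>
        (\<forall>H\<in>{half_space X p q, half_space X q p}. \<forall>x\<in>H. \<forall>y\<in>H.
           gdist X x (\<sigma> y) \<ge> gdist X x y))"

text \<open>The point with normal coordinates \<open>(r, u)\<close>.\<close>

fun normal_point :: "geometry \<Rightarrow> real \<times> 'v::euclidean_space \<Rightarrow> real \<times> 'v" where
  "normal_point Spherical (r, u) = (cos r, sin r *\<^sub>R u)"
| "normal_point Euclidean (r, u) = (1, r *\<^sub>R u)"
| "normal_point Hyperbolic (r, u) = (cosh r, sinh r *\<^sub>R u)"

text \<open>
  The reflection \<open>\<sigma>\<^sub>\<omega>\<close>. The reflection mapping the origin to a given other point is unique on the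
  model; its values elsewhere are irrelevant. If \<open>\<omega>\<close> represents the origin (excluded for the
  parameters of a polarization), the identity serves as a dummy value.
\<close>

definition refl_param ::
  "geometry \<Rightarrow> real \<times> 'v::euclidean_space \<Rightarrow> real \<times> 'v \<Rightarrow> real \<times> 'v" where
  "refl_param X \<omega> =
     (if normal_point X \<omega> = origin then id
      else (SOME \<sigma>. is_reflection X \<sigma> \<and> \<sigma> origin = normal_point X \<omega>))"

text \<open>
  On the common boundary of the half-spaces \<open>H\<^sup>+\<close> and \<open>H\<^sup>-\<close> the reflection is the identity, so both
  cases give the same value there.
\<close>

definition polarization ::
  "geometry \<Rightarrow> real \<times> 'v::euclidean_space \<Rightarrow> (real \<times> 'v \<Rightarrow> real) \<Rightarrow> real \<times> 'v \<Rightarrow> real" where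
  "polarization X \<omega> f x =
     (if gdist X x origin \<le> gdist X (refl_param X \<omega> x) origin
      then max (f x) (f (refl_param X \<omega> x))
      else min (f x) (f (refl_param X \<omega> x)))"

text \<open>\<open>polarizations X \<omega> n\<close> is \<open>S\<^bsub>\<omega>\<^sub>1\<dots>\<omega>\<^sub>n\<^esub>\<close>; the entry \<open>\<omega> 0\<close> is not used.\<close>

primrec polarizations ::
  "geometry \<Rightarrow> (nat \<Rightarrow> real \<times> 'v::euclidean_space) \<Rightarrow> nat \<Rightarrow>
     (real \<times> 'v \<Rightarrow> real) \<Rightarrow> real \<times> 'v \<Rightarrow> real" where
  "polarizations X \<omega> 0 f = f"
| "polarizations X \<omega> (Suc n) f = polarization X (\<omega> (Suc n)) (polarizations X \<omega> n f)"

definition sup_norm :: "geometry \<Rightarrow> (real \<times> 'v::euclidean_space \<Rightarrow> real) \<Rightarrow> real" where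
  "sup_norm X g = (SUP x\<in>model X. \<bar>g x\<bar>)"

definition Cc_plus :: "geometry \<Rightarrow> (real \<times> 'v::euclidean_space \<Rightarrow> real) set" where
  "Cc_plus X = {g. continuous_on (model X) g \<and> (\<forall>x\<in>model X. 0 \<le> g x) \<and>
                   compact (closure {x \<in> model X. g x \<noteq> 0})}"

definition Omega :: "(real \<times> 'v::euclidean_space) set" where
  "Omega = {0..} \<times> sphere 0 1"

text \<open>The parameters that are used for the given geometry; density in \<open>\<Omega>\<close> refers to this set.\<close>

definition Omega_used :: "geometry \<Rightarrow> (real \<times> 'v::euclidean_space) set" where
  "Omega_used X = (if X = Spherical then {0..pi} \<times> sphere 0 1 else Omega)"

end

theory Submission
  imports Defs
begin

text \<open>
  All three geometries are treated at once through the bilinear form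
  \<open>bil (t, v) (t', v') = v \<bullet> v' + \<kappa> t t'\<close> with \<open>\<kappa> = 1, 0, -1\<close>: the distance of two points of
  the model is an increasing function of \<open>bil (x - y) (x - y)\<close>, and the reflection that exchanges two
  points is affine. A polarization sends a tent \<open>[1 - d(x,a)]\<^sup>+\<close> to the tent centred at the one of
  \<open>a\<close> and its mirror image that is closer to \<open>o\<close>, so polarizing a tent moves a single point, and
  the sup norm distance of the tent to its rearrangement is \<open>min 1 (d(a,o))\<close>.

  (a) If \<open>d(a,o) \<le> 1\<close>, the reflections with parameters \<open>(r,u)\<close> and \<open>(r,-u)\<close> cannot both move
  \<open>a\<close>. By symmetry, each step leaves \<open>a\<close> fixed with probability at least \<open>1/2\<close>.

  (b) Reflections in hyperplanes close to \<open>o\<close> throw the point back and forth across \<open>o\<close> at an arbitrarily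
  small loss of distance. Before a prescribed parameter is used, the point can be thrown to the side on
  which that parameter does not move it.

  The rearrangement of a tent is the tent centred at \<open>o\<close> since balls of equal radius have equal volume. The
  volume of a set \<open>A\<close> is a constant multiple of the Lebesgue measure of the cone
  \<open>{s x | 0 < s < 1, x \<in> A}\<close>, which is invariant under linear involutions.
\<close>

text \<open>Reflections and the rearrangement both enter the theorem through a Hilbert choice, so
  each has to be shown unique before anything can be computed. For reflections the obstacle is that
  the half-spaces exchanged by an arbitrary reflection are not known to be bounded by the mirror
  between \<open>o\<close> and its image. For the rearrangement it is that \<open>gvolume\<close> is
  a chart integral without visible symmetry; passing to cones makes usable that the reflections are
  linear maps of the ambient space outside the Euclidean case. The radius of the tent matters
  because 1 < \<pi>/2. Balls about \<open>o\<close> of radius at most 1 lie in the open upper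
  hemisphere, where they are graphs over the chart. A centre at distance at most 1 from
  \<open>o\<close> has a nonnegative first coordinate, and then a reflection moves it only if its
  direction makes an acute angle with that of the centre. This sign condition is reversed by passing
  from u to -u, which drives both (a) and (b). In (a) it is enough to watch the events that single
  reflections leave the initial centre in place, so independence yields the factor 2^-n without
  following the random path.\<close>

section \<open>A common bilinear form for the three geometries\<close>

fun curv :: "geometry \<Rightarrow> real" where
  "curv Spherical = 1" | "curv Euclidean = 0" | "curv Hyperbolic = -1"

definition bil :: "geometry \<Rightarrow> real \<times> 'v::euclidean_space \<Rightarrow> real \<times> 'v \<Rightarrow> real" where
  "bil X x y = snd x \<bullet> snd y + curv X * (fst x * fst y)"

abbreviation quad :: "geometry \<Rightarrow> real \<times> 'v::euclidean_space \<Rightarrow> real" where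
  "quad X x \<equiv> bil X x x"

lemma bil_simps [simp]:
  "bil X (x + y) z = bil X x z + bil X y z"
  "bil X (x - y) z = bil X x z - bil X y z"
  "bil X z (x + y) = bil X z x + bil X z y"
  "bil X z (x - y) = bil X z x - bil X z y"
  "bil X (c *\<^sub>R x) z = c * bil X x z"
  "bil X z (c *\<^sub>R x) = c * bil X z x"
  "bil X (- x) z = - bil X x z"
  "bil X z (- x) = - bil X z x"
  "bil X 0 z = 0"
  "bil X z 0 = 0"
  by (simp_all add: bil_def algebra_simps)

lemma bil_commute: "bil X x y = bil X y x"
  by (simp add: bil_def inner_commute mult.commute)

lemma model_iff:
  "x \<in> model X \<longleftrightarrow> (fst x)\<^sup>2 + curv X * (snd x \<bullet> snd x) = 1 \<and> (X \<noteq> Spherical \<longrightarrow> 0 < fst x)"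
proof (cases X)
  case Spherical
  have "norm x = 1 \<longleftrightarrow> x \<bullet> x = 1"
    by (simp add: norm_eq_1)
  then show ?thesis using Spherical by (simp add: inner_prod_def power2_eq_square)
next
  case Euclidean
  then show ?thesis by (auto simp: power2_eq_1_iff)
qed auto

lemma quad_model: "x \<in> model X \<Longrightarrow> X \<noteq> Euclidean \<Longrightarrow> quad X x = curv X"
  using model_iff[of x X] by (cases X) (auto simp: bil_def power2_eq_square algebra_simps)

lemma model_gt0: "x \<in> model X \<Longrightarrow> X \<noteq> Spherical \<Longrightarrow> 0 < fst x"
  by (simp add: model_iff)

lemma origin_in_model [simp]: "origin \<in> model X"
  by (cases X) (auto simp: origin_def norm_Pair)

text \<open>Reversed Cauchy-Schwarz inequality. The difference of \<open>(t * s)\<^sup>2\<close> and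
  \<open>(1 + v \<bullet> w)\<^sup>2\<close> equals the square of \<open>norm (v - w)\<close> plus
  the Cauchy-Schwarz defect of v and w. Both terms are nonnegative, and equality forces v =
  w.\<close>

lemma hyperbolic_bil_le:
  assumes "x \<in> model Hyperbolic" "y \<in> model Hyperbolic"
  shows "bil Hyperbolic x y \<le> -1" "bil Hyperbolic x y = -1 \<Longrightarrow> x = y"
proof -
  obtain t v where x: "x = (t, v)" by force
  obtain s w where y: "y = (s, w)" by force
  have t: "t\<^sup>2 = 1 + v \<bullet> v" "t > 0" and s: "s\<^sup>2 = 1 + w \<bullet> w" "s > 0"
    using assms by (auto simp: x y)
  have "(1 + v \<bullet> w)\<^sup>2 + (norm (v - w))\<^sup>2 + ((norm v * norm w)\<^sup>2 - (v \<bullet> w)\<^sup>2) = (t * s)\<^sup>2"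
    unfolding power_mult_distrib t s power2_norm_eq_inner
    by (simp add: algebra_simps power2_eq_square inner_commute)
  moreover have "(v \<bullet> w)\<^sup>2 \<le> (norm v * norm w)\<^sup>2"
    by (metis Cauchy_Schwarz_ineq2 abs_ge_zero power2_abs power_mono)
  ultimately have *: "(1 + v \<bullet> w)\<^sup>2 + (norm (v - w))\<^sup>2 \<le> (t * s)\<^sup>2" by linarith
  then have "(1 + v \<bullet> w)\<^sup>2 \<le> (t * s)\<^sup>2" by (smt (verit) zero_le_power2)
  moreover have "0 < t * s" using t s by simp
  ultimately have "1 + v \<bullet> w \<le> t * s"
    by (metis less_eq_real_def power2_le_imp_le)
  then show "bil Hyperbolic x y \<le> -1" by (simp add: bil_def x y)
  assume "bil Hyperbolic x y = -1"
  then have "1 + v \<bullet> w = t * s" by (simp add: bil_def x y)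
  with * have "v = w" by simp
  with t s have "t = s" by (metis less_eq_real_def power2_eq_imp_eq)
  with \<open>v = w\<close> show "x = y" by (simp add: x y)
qed

lemma quad_diff:
  "X \<noteq> Euclidean \<Longrightarrow> x \<in> model X \<Longrightarrow> y \<in> model X \<Longrightarrow> quad X (x - y) = 2 * curv X - 2 * bil X x y"
  by (simp add: quad_model bil_commute)

lemma quad_Spherical: "quad Spherical x = (norm x)\<^sup>2"
  by (simp add: bil_def power2_norm_eq_inner inner_prod_def)

lemma quad_Euclidean: "quad Euclidean x = (norm (snd x))\<^sup>2"
  by (simp add: bil_def power2_norm_eq_inner)

lemma quad_nonneg: "x \<in> model X \<Longrightarrow> y \<in> model X \<Longrightarrow> 0 \<le> quad X (x - y)"
  using hyperbolic_bil_le(1)[of x y] quad_diff[of X x y]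
  by (cases X) (simp_all only: quad_Spherical quad_Euclidean zero_le_power2, auto)

lemma quad_eq_0:
  assumes "x \<in> model X" "y \<in> model X"
  shows "quad X (x - y) = 0 \<longleftrightarrow> x = y"
proof (cases X)
  case Spherical
  then show ?thesis by (simp only: quad_Spherical) simp
next
  case Euclidean
  then show ?thesis using assms by (simp only: quad_Euclidean) (auto simp: prod_eq_iff)
next
  case Hyperbolic
  then show ?thesis using assms hyperbolic_bil_le(2)[of x y] quad_diff[of X x y] by auto
qed

lemma quad_pos: "x \<in> model X \<Longrightarrow> y \<in> model X \<Longrightarrow> x \<noteq> y \<Longrightarrow> 0 < quad X (x - y)"
  using quad_nonneg quad_eq_0 by (metis less_eq_real_def)

lemma bil_Spherical: "bil Spherical x y = x \<bullet> y"
  by (simp add: bil_def inner_prod_def)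

lemma bil_Spherical_bound:
  "x \<in> model Spherical \<Longrightarrow> y \<in> model Spherical \<Longrightarrow> \<bar>bil Spherical x y\<bar> \<le> 1"
  using Cauchy_Schwarz_ineq2[of x y] by (simp add: bil_Spherical)

lemma gdist_Spherical: "gdist Spherical x y = arccos (bil Spherical x y)"
  by (simp add: bil_Spherical)

lemma gdist_Hyperbolic: "gdist Hyperbolic x y = arcosh (- bil Hyperbolic x y)"
  by (simp add: bil_def)

lemma gdist_Euclidean:
  "x \<in> model Euclidean \<Longrightarrow> y \<in> model Euclidean \<Longrightarrow> gdist Euclidean x y = sqrt (quad Euclidean (x - y))"
  by (simp only: quad_Euclidean) (simp add: dist_norm norm_prod_def)

lemma gdist_less_iff:
  assumes "x \<in> model X" "y \<in> model X" "z \<in> model X" "w \<in> model X"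
  shows "gdist X x y < gdist X z w \<longleftrightarrow> quad X (x - y) < quad X (z - w)"
proof (cases X)
  case Spherical
  then show ?thesis
    using assms bil_Spherical_bound[of x y] bil_Spherical_bound[of z w]
    by (simp add: quad_diff gdist_Spherical arccos_less_mono del: gdist.simps bil_simps)
next
  case Euclidean
  then show ?thesis using assms by (simp add: gdist_Euclidean del: gdist.simps bil_simps)
next
  case Hyperbolic
  then show ?thesis
    using assms hyperbolic_bil_le[of x y] hyperbolic_bil_le[of z w]
    by (simp add: quad_diff gdist_Hyperbolic del: gdist.simps bil_simps)
qed

lemma gdist_le_iff:
  assumes "x \<in> model X" "y \<in> model X" "z \<in> model X" "w \<in> model X"
  shows "gdist X x y \<le> gdist X z w \<longleftrightarrow> quad X (x - y) \<le> quad X (z - w)"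
  using gdist_less_iff[of z X w x y] assms by (simp add: not_less[symmetric] del: bil_simps)

lemma gdist_eq_iff:
  assumes "x \<in> model X" "y \<in> model X" "z \<in> model X" "w \<in> model X"
  shows "gdist X x y = gdist X z w \<longleftrightarrow> quad X (x - y) = quad X (z - w)"
  using gdist_le_iff[OF assms] gdist_le_iff[of z X w x y] assms by (metis order_antisym_conv order_refl)

lemma gdist_commute: "gdist X x y = gdist X y x"
  by (cases X) (simp_all add: inner_commute dist_commute mult.commute)

lemma gdist_self: "x \<in> model X \<Longrightarrow> gdist X x x = 0"
  by (cases X) (simp_all add: power2_eq_square norm_eq_1)

lemma gdist_nonneg:
  assumes "x \<in> model X" "y \<in> model X"
  shows "0 \<le> gdist X x y"
  using gdist_le_iff[of x X x x y] assms quad_nonneg[of x X y] by (simp add: gdist_self)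

lemma gdist_eq_0_iff: "x \<in> model X \<Longrightarrow> y \<in> model X \<Longrightarrow> gdist X x y = 0 \<longleftrightarrow> x = y"
  using gdist_eq_iff[of x X y x x] quad_eq_0[of x X y] by (simp add: gdist_self)

section \<open>Reflections as affine maps\<close>

text \<open>The quadratic terms in z cancel, so this algebraic form of the comparison of the
  distances from z to p and to q is affine in z. Its zero set is the mirror.\<close>

definition side :: "geometry \<Rightarrow> real \<times> 'v::euclidean_space \<Rightarrow> real \<times> 'v \<Rightarrow> real \<times> 'v \<Rightarrow> real" where
  "side X p q z = quad X (z - p) - quad X (z - q)"

text \<open>The value is \<open>z\<close> if \<open>p = q\<close>, by division by zero.\<close>

definition reflect ::
  "geometry \<Rightarrow> real \<times> 'v::euclidean_space \<Rightarrow> real \<times> 'v \<Rightarrow> real \<times> 'v \<Rightarrow> real \<times> 'v" where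
  "reflect X p q z = z + (side X p q z / quad X (p - q)) *\<^sub>R (p - q)"

lemma side_eq: "side X p q z = quad X p - quad X q - 2 * bil X z (p - q)"
  by (simp add: side_def bil_commute)

lemma side_diff: "side X p q z - side X p q w = - 2 * bil X (z - w) (p - q)"
  by (simp add: side_eq)

lemma side_self [simp]: "side X p p z = 0"
  by (simp add: side_def)

lemma side_swap: "side X q p z = - side X p q z"
  by (simp add: side_def)

lemma reflect_same [simp]: "reflect X p p z = z"
  by (simp add: reflect_def)

lemma quad_diff_scaleR: "quad X (d - c *\<^sub>R n) = quad X d - 2 * c * bil X d n + c * (c * quad X n)"
  by (simp add: bil_commute[of X n d] right_diff_distrib)

locale mirror =
  fixes X :: geometry and p q :: "real \<times> 'v::euclidean_space"
  assumes p: "p \<in> model X" and q: "q \<in> model X" and pq: "p \<noteq> q"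
begin

abbreviation "N \<equiv> quad X (p - q)"

lemma N: "N > 0" by (rule quad_pos[OF p q pq])

lemma side_reflect: "side X p q (reflect X p q z) = - side X p q z"
proof -
  have "side X p q (reflect X p q z) - side X p q z
      = - 2 * bil X (reflect X p q z - z) (p - q)" by (rule side_diff)
  also have "\<dots> = - 2 * side X p q z"
    using N by (simp add: reflect_def del: bil_simps(1-4))
  finally show ?thesis by simp
qed

lemma reflect_reflect [simp]: "reflect X p q (reflect X p q z) = z"
  by (simp add: reflect_def[of X p q "reflect X p q z"] side_reflect) (simp add: reflect_def)

lemma reflect_p: "reflect X p q p = q"
proof -
  have "side X p q p = - N" by (simp add: side_def)
  then show ?thesis using N by (simp add: reflect_def del: bil_simps)
qed

lemma reflect_q: "reflect X p q q = p"
  using reflect_reflect[of p] reflect_p by simp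

text \<open>Every distance comparison below is read off from this identity: reflecting one of two
  points increases or decreases their distance according to the sign of the product of their
  sides.\<close>

lemma quad_reflect_right:
  "quad X (x - reflect X p q y) = quad X (x - y) + side X p q x * side X p q y / N"
proof -
  define c where "c = side X p q y / N"
  have c: "c * N = side X p q y" using N by (simp add: c_def)
  have "quad X (x - reflect X p q y) = quad X ((x - y) - c *\<^sub>R (p - q))"
    by (simp add: reflect_def c_def algebra_simps)
  also have "\<dots> = quad X (x - y) - 2 * c * bil X (x - y) (p - q) + c * (c * N)"
    by (rule quad_diff_scaleR)
  also have "\<dots> = quad X (x - y) + c * (side X p q x - side X p q y) + c * side X p q y"
    by (simp add: side_diff c del: bil_simps(1-4))
  also have "\<dots> = quad X (x - y) + side X p q x * side X p q y / N"
    by (simp add: c_def right_diff_distrib diff_divide_distrib mult.commute del: bil_simps)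
  finally show ?thesis .
qed

lemma quad_reflect_reflect: "quad X (reflect X p q x - reflect X p q y) = quad X (x - y)"
proof -
  have "quad X (reflect X p q x - reflect X p q y) =
        quad X (y - reflect X p q x) + side X p q (reflect X p q x) * side X p q y / N"
    by (subst quad_reflect_right) (simp add: bil_commute)
  also have "\<dots> = quad X (y - x)"
    by (subst quad_reflect_right) (simp add: side_reflect del: bil_simps)
  finally show ?thesis by (simp add: bil_commute)
qed

text \<open>Outside the Euclidean case 0 lies on the mirror, so the reflection preserves
  \<open>quad X\<close> itself. In the hyperbolic case the lower sheet must also be excluded: if the
  image y of x were on it, applying \<open>hyperbolic_bil_le\<close> to -y and q would make
  \<open>quad X (y - q)\<close> negative, although it equals \<open>quad X (x - p)\<close>.\<close>

lemma reflect_in_model: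
  assumes "x \<in> model X"
  shows "reflect X p q x \<in> model X"
proof (cases "X = Euclidean")
  case True
  then show ?thesis using assms p q by (simp add: reflect_def del: bil_simps)
next
  case False
  define y where "y = reflect X p q x"
  have side0: "side X p q 0 = 0" using False p q by (simp add: side_eq quad_model)
  have "quad X y = quad X (reflect X p q 0 - reflect X p q x)"
    by (simp add: reflect_def[of X p q 0] side0 y_def)
  also have "\<dots> = quad X x" by (subst quad_reflect_reflect) simp
  finally have Q: "quad X y = curv X" using quad_model False assms by metis
  have sq: "(fst y)\<^sup>2 + curv X * (snd y \<bullet> snd y) = 1"
    using Q False by (cases X) (auto simp: bil_def algebra_simps power2_eq_square)
  have "0 < fst y" if "X \<noteq> Spherical"
  proof (rule ccontr)
    have X: "X = Hyperbolic" using that False by (cases X) auto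
    assume "\<not> 0 < fst y"
    then have "0 < fst (- y)" using sq X
      by (smt (verit) curv.simps(3) fst_uminus inner_ge_zero power2_eq_square zero_less_mult_iff)
    then have "- y \<in> model X" using sq X by (auto simp: model_iff)
    then have "bil X (- y) q \<le> -1" using hyperbolic_bil_le(1) q X by blast
    moreover have "quad X (y - q) = quad X (x - p)"
      unfolding y_def using quad_reflect_reflect[of x p] by (simp only: reflect_p)
    moreover have "quad X (y - q) = -2 - 2 * bil X y q"
      using Q q X False by (simp add: quad_model bil_commute)
    ultimately show False using quad_nonneg[OF assms p] by simp
  qed
  then show ?thesis using sq by (simp add: model_iff y_def)
qed

lemma gdist_reflect_reflect:
  "x \<in> model X \<Longrightarrow> y \<in> model X \<Longrightarrow> gdist X (reflect X p q x) (reflect X p q y) = gdist X x y"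
  by (simp add: gdist_eq_iff reflect_in_model quad_reflect_reflect del: bil_simps)

lemma gdist_reflect_le:
  assumes "x \<in> model X" "y \<in> model X" "side X p q x * side X p q y \<ge> 0"
  shows "gdist X x y \<le> gdist X x (reflect X p q y)"
  using assms N by (simp add: gdist_le_iff reflect_in_model quad_reflect_right del: bil_simps)

lemma gdist_reflect_ge:
  assumes "x \<in> model X" "y \<in> model X" "side X p q x * side X p q y \<le> 0"
  shows "gdist X x (reflect X p q y) \<le> gdist X x y"
  using assms N
  by (simp add: gdist_le_iff reflect_in_model quad_reflect_right divide_nonpos_pos del: bil_simps)

lemma half_space_iff: "x \<in> half_space X p q \<longleftrightarrow> x \<in> model X \<and> side X p q x \<le> 0"
  using p q by (auto simp: half_space_def gdist_le_iff side_def simp del: bil_simps)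

lemma half_space_iff': "x \<in> half_space X q p \<longleftrightarrow> x \<in> model X \<and> 0 \<le> side X p q x"
  using p q by (auto simp: half_space_def gdist_le_iff side_def simp del: bil_simps)

lemma is_reflection_reflect: "is_reflection X (reflect X p q)"
proof -
  have inv: "f ` A = B" if "\<And>x. x \<in> A \<Longrightarrow> f x \<in> B" "\<And>x. x \<in> B \<Longrightarrow> f x \<in> A" "\<And>x. f (f x) = x"
    for f :: "real \<times> 'v \<Rightarrow> real \<times> 'v" and A B
    using that by (metis image_eqI image_subsetI subsetI subset_antisym)
  have "reflect X p q ` model X = model X"
    by (rule inv) (auto simp: reflect_in_model)
  moreover have "reflect X p q ` half_space X p q = half_space X q p"
    by (rule inv) (auto simp: half_space_iff half_space_iff' reflect_in_model side_reflect)
  moreover have "\<forall>H\<in>{half_space X p q, half_space X q p}. \<forall>x\<in>H. \<forall>y\<in>H.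
           gdist X x (reflect X p q y) \<ge> gdist X x y"
    by (auto simp: half_space_iff half_space_iff' simp del: split_paired_All
        intro!: gdist_reflect_le intro: mult_nonneg_nonneg mult_nonpos_nonpos)
  ultimately show ?thesis unfolding is_reflection_def
    using p q pq by (auto simp: gdist_reflect_reflect simp del: bil_simps)
qed

end

subsection \<open>Uniqueness of reflections\<close>

text \<open>Outside the Euclidean case the constant term of \<open>side\<close> vanishes and any
  factor l can be pulled out; a Euclidean \<open>side\<close> is only affine, hence l = 1
  there.\<close>

lemma side_linear:
  assumes "p \<in> model X" "q \<in> model X" "X = Euclidean \<Longrightarrow> l = 1" "a + b = 1"
  shows "side X p q (l *\<^sub>R (a *\<^sub>R z + b *\<^sub>R w)) = l * (a * side X p q z + b * side X p q w)"
proof (cases "X = Euclidean")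
  case True
  have "side X p q (a *\<^sub>R z + b *\<^sub>R w) = (a + b) * (quad X p - quad X q)
      - 2 * (a * bil X z (p - q) + b * bil X w (p - q))"
    unfolding side_eq using assms(4) by (simp add: algebra_simps)
  then show ?thesis using assms(3)[OF True] by (simp add: side_eq algebra_simps)
next
  case False
  then have "quad X p - quad X q = 0" using assms by (simp add: quad_model)
  then show ?thesis by (simp add: side_eq algebra_simps)
qed

text \<open>A point of the geodesic segment is obtained by projecting a point of the chord radially
  back to the model. On the sphere only a chord through 0 prevents this. In the hyperbolic case
  \<open>hyperbolic_bil_le\<close> bounds \<open>quad X\<close> on the chord by -1, so the
  normalizing root exists.\<close>

lemma exists_normalized_combination:
  assumes z: "z \<in> model X" and w: "w \<in> model X" and "z \<noteq> - w"
    and ab: "a > 0" "b > 0" "a + b = 1"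
  obtains l where "l > 0" "l *\<^sub>R (a *\<^sub>R z + b *\<^sub>R w) \<in> model X" "X = Euclidean \<Longrightarrow> l = 1"
proof (cases X)
  case Spherical
  have "a *\<^sub>R z + b *\<^sub>R w \<noteq> 0"
  proof
    assume 0: "a *\<^sub>R z + b *\<^sub>R w = 0"
    then have "a *\<^sub>R z = - (b *\<^sub>R w)" by (simp add: eq_neg_iff_add_eq_0)
    then have "norm (a *\<^sub>R z) = norm (b *\<^sub>R w)" by simp
    then have "a = b" using z w ab Spherical by simp
    then have "a *\<^sub>R (z + w) = 0" using 0 by (simp add: scaleR_add_right)
    then show False using \<open>z \<noteq> - w\<close> ab by (simp add: eq_neg_iff_add_eq_0)
  qed
  then show ?thesis using that[of "1 / norm (a *\<^sub>R z + b *\<^sub>R w)"] Spherical by simp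
next
  case Euclidean
  then show ?thesis using that[of 1] z w ab by simp
next
  case Hyperbolic
  let ?y = "a *\<^sub>R z + b *\<^sub>R w"
  have "quad X ?y = - a\<^sup>2 - b\<^sup>2 + 2 * (a * b) * bil X z w"
    using z w Hyperbolic by (simp add: quad_model bil_commute[of _ w z] algebra_simps power2_eq_square)
  also have "\<dots> \<le> - a\<^sup>2 - b\<^sup>2 + 2 * (a * b) * (-1)"
    using hyperbolic_bil_le(1)[of z w] z w Hyperbolic ab
    by (intro add_left_mono mult_left_mono) auto
  also have "\<dots> = - (a + b)\<^sup>2" by (simp add: power2_eq_square algebra_simps)
  finally have neg: "quad X ?y \<le> - 1" using ab by simp
  let ?l = "1 / sqrt (- quad X ?y)"
  have l: "?l > 0" using neg by (simp del: bil_simps)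
  have "?l\<^sup>2 = 1 / (- quad X ?y)" using neg by (simp add: power_divide del: bil_simps)
  then have "quad X (?l *\<^sub>R ?y) = -1"
    using neg by (subst bil_simps(5), subst bil_simps(6)) (simp add: power2_eq_square field_simps del: bil_simps)
  moreover have "fst ?y > 0" using z w Hyperbolic ab by (simp add: model_gt0 add_pos_pos)
  then have "fst (?l *\<^sub>R ?y) > 0" using l by (metis fst_scaleR mult_pos_pos real_scaleR_def)
  ultimately have "?l *\<^sub>R ?y \<in> model X"
    using Hyperbolic by (simp only: model_iff) (simp add: bil_def power2_eq_square del: bil_simps)
  then show ?thesis using that[of ?l] l Hyperbolic by simp
qed

lemma nonneg_of_segment:
  fixes a b :: real
  assumes "\<And>e. 0 < e \<Longrightarrow> e < 1 \<Longrightarrow> 0 \<le> (1 - e) * a + e * b"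
  shows "0 \<le> a"
proof (rule tendsto_lowerbound)
  show "((\<lambda>e. (1 - e) * a + e * b) \<longlongrightarrow> a) (at_right 0)"
    by (auto intro!: tendsto_eq_intros)
  show "\<forall>\<^sub>F e in at_right 0. 0 \<le> (1 - e) * a + e * b"
    by (rule eventually_mono[OF eventually_at_right_real[of 0 1]]) (auto simp: assms)
qed auto

context mirror
begin

lemma side_p: "side X p q p < 0"
  using N by (simp add: side_def del: bil_simps(1-4))

text \<open>Allows \<open>exists_normalized_combination\<close> to join p to any point of the
  mirror.\<close>

lemma side_antipode_p: "- p \<in> model X \<Longrightarrow> side X p q (- p) \<noteq> 0"
proof
  assume m: "- p \<in> model X" and 0: "side X p q (- p) = 0"
  have X: "X \<noteq> Euclidean" using m p by auto
  have "bil X p p - bil X p q = 0" using 0 X p q by (simp add: side_eq quad_model)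
  then have "quad X (p - q) = 0" using X p q by (simp add: quad_model bil_commute[of X q p])
  then show False using N by simp
qed

lemma mirror_swap: "mirror X q p"
  using p q pq by unfold_locales auto

text \<open>The open half-space around \<open>p\<close> lies in \<open>H\<close>, and every point of the mirror is a limit of its points.\<close>

lemma boundary_subset_half_space:
  assumes p': "p' \<in> model X" and q': "q' \<in> model X"
    and sub: "\<And>x. x \<in> model X \<Longrightarrow> side X p q x < 0 \<Longrightarrow> side X p' q' x \<le> 0"
    and z: "z \<in> model X" "side X p q z = 0"
  shows "side X p' q' z \<le> 0"
proof -
  have "0 \<le> (1 - e) * (- side X p' q' z) + e * (- side X p' q' p)" if e: "0 < e" "e < 1" for e
  proof -
    have "z \<noteq> - p" using side_antipode_p z by auto
    then obtain l where l: "l > 0" "l *\<^sub>R ((1 - e) *\<^sub>R z + e *\<^sub>R p) \<in> model X" "X = Euclidean \<Longrightarrow> l = 1"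
      using exists_normalized_combination[OF z(1) p, of "1 - e" e] e by auto
    have "side X p q (l *\<^sub>R ((1 - e) *\<^sub>R z + e *\<^sub>R p)) < 0"
      using side_linear[OF p q l(3), of "1 - e" e z p] side_p z e l by (simp add: mult_pos_neg)
    from sub[OF l(2) this] have "l * ((1 - e) * side X p' q' z + e * side X p' q' p) \<le> 0"
      using side_linear[OF p' q' l(3), of "1 - e" e z p] by simp
    then show ?thesis using l(1) by (simp add: mult_le_0_iff)
  qed
  from nonneg_of_segment[OF this] show ?thesis by simp
qed

text \<open>Let H be the half-space of \<sigma> that contains p. Each z in H is at least as close to
  p as to \<open>\<sigma> p = q\<close>, so H lies on the side of p, and likewise its complement
  lies on the side of q. Points of the mirror of p and q are limits from both sides, hence belong to
  both half-spaces of \<sigma>; there the inequality for \<sigma> bounds the distance of z and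
  \<sigma> z by 0. So \<sigma> fixes the mirror, and together with the swap of p and q this
  determines it.\<close>

lemma reflection_unique_aux:
  assumes maps: "\<And>x. x \<in> model X \<Longrightarrow> \<sigma> x \<in> model X"
    and iso: "\<And>x y. x \<in> model X \<Longrightarrow> y \<in> model X \<Longrightarrow> gdist X (\<sigma> x) (\<sigma> y) = gdist X x y"
    and inv: "\<And>x. x \<in> model X \<Longrightarrow> \<sigma> (\<sigma> x) = x"
    and m': "mirror X p' q'"
    and swap: "\<And>x. x \<in> half_space X p' q' \<Longrightarrow> \<sigma> x \<in> half_space X q' p'"
      "\<And>x. x \<in> half_space X q' p' \<Longrightarrow> \<sigma> x \<in> half_space X p' q'"
    and le: "\<And>x y. x \<in> half_space X p' q' \<Longrightarrow> y \<in> half_space X p' q' \<Longrightarrow> gdist X x y \<le> gdist X x (\<sigma> y)"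
      "\<And>x y. x \<in> half_space X q' p' \<Longrightarrow> y \<in> half_space X q' p' \<Longrightarrow> gdist X x y \<le> gdist X x (\<sigma> y)"
    and pq': "\<sigma> p = q" and pH: "p \<in> half_space X p' q'"
    and x: "x \<in> model X"
  shows "\<sigma> x = reflect X p q x"
proof -
  interpret m': mirror X p' q' by fact
  have qH: "q \<in> half_space X q' p'" using swap(1)[OF pH] pq' by simp
  have \<sigma>q: "\<sigma> q = p" using inv[OF p] pq' by simp
  have side_leI: "side X p q z \<le> 0" if "z \<in> half_space X p' q'" for z
    using le(1)[OF that pH] that half_space_iff[of z] by (simp add: pq' half_space_def)
  have side_geI: "side X p q z \<ge> 0" if "z \<in> half_space X q' p'" for z
    using le(2)[OF that qH] that half_space_iff'[of z] by (simp add: \<sigma>q half_space_def)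
  have cover: "z \<in> half_space X p' q' \<or> z \<in> half_space X q' p'" if "z \<in> model X" for z
    using that by (auto simp: half_space_def)
  have fixed: "\<sigma> z = z" if z: "z \<in> model X" "side X p q z = 0" for z
  proof -
    interpret sw: mirror X q p by (rule mirror_swap)
    have "side X p' q' z \<le> 0"
      using boundary_subset_half_space[OF m'.p m'.q _ z] cover side_geI m'.half_space_iff
      by (metis not_le)
    moreover have "side X q' p' z \<le> 0"
    proof (rule sw.boundary_subset_half_space[OF m'.q m'.p _ z(1)])
      show "side X q' p' y \<le> 0" if "y \<in> model X" "side X q p y < 0" for y
      proof -
        have "y \<notin> half_space X p' q'"
          using side_leI[of y] that side_swap[of X q p y] by auto
        then show ?thesis
          using cover[OF that(1)] m'.half_space_iff'[of y] side_swap[of X q' p' y] by simp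
      qed
      show "side X q p z = 0" using z side_swap[of X q p z] by simp
    qed
    ultimately have H: "z \<in> half_space X p' q'" "z \<in> half_space X q' p'"
      using z by (auto simp: m'.half_space_iff m'.half_space_iff' side_swap[of X q' p'])
    have "gdist X (\<sigma> z) z \<le> gdist X (\<sigma> z) (\<sigma> z)"
      using le(1)[OF swap(2)[OF H(2)] H(1)] .
    then have "gdist X (\<sigma> z) z = 0"
      using maps z gdist_nonneg[of "\<sigma> z" X z] by (simp add: gdist_self)
    then show ?thesis using gdist_eq_0_iff maps z by metis
  qed
  define y where "y = \<sigma> x"
  define y' where "y' = reflect X p q x"
  have y: "y \<in> model X" and y': "y' \<in> model X"
    using x by (auto simp: y_def y'_def maps reflect_in_model)
  define c where "c = side X p q x / N"
  have y'_eq: "y' = x + c *\<^sub>R (p - q)" by (simp add: y'_def reflect_def c_def)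
  have "quad X (y - p) = quad X (x - q)" "quad X (y - q) = quad X (x - p)"
    using iso[OF x q] iso[OF x p] x p q y by (auto simp: gdist_eq_iff y_def \<sigma>q pq' simp del: bil_simps)
  then have "side X p q y = - side X p q x" by (simp add: side_def del: bil_simps)
  then have "side X p q y = side X p q y'" by (simp only: y'_def side_reflect)
  then have 0: "bil X (y - y') (p - q) = 0"
    using side_diff[of X p q y y'] by simp
  have "quad X (y - y') = 0"
  proof (cases "x = - y'")
    \<comment> \<open>Antipodal points have no midpoint. But here y' is half of a multiple of p - q,
      so the orthogonality \<open>0\<close> already gives \<open>bil X y y' = 1\<close>, that is y =
      y'.\<close>
    case True
    have "fst x = - fst y'" using True by simp
    then have X: "X = Spherical" using model_gt0[OF x] model_gt0[OF y'] by linarith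
    have "2 *\<^sub>R y' = c *\<^sub>R (p - q)" using y'_eq unfolding True by (simp add: scaleR_2) (metis add_uminus_conv_diff diff_eq_eq diff_minus_eq_add)
    then have "bil X (y - y') (2 *\<^sub>R y') = 0" using 0 by (metis bil_simps(6) mult_zero_right)
    then have "bil X y y' = 1" using quad_model[OF y'] X by simp
    then show ?thesis using quad_diff[OF _ y y'] X by simp
  next
    case False
    then obtain l where l: "l > 0" "l *\<^sub>R ((1/2) *\<^sub>R x + (1/2) *\<^sub>R y') \<in> model X" "X = Euclidean \<Longrightarrow> l = 1"
      using exists_normalized_combination[OF x y', of "1/2" "1/2"] by auto
    define w where "w = l *\<^sub>R ((1/2) *\<^sub>R x + (1/2) *\<^sub>R y')"
    have w: "w \<in> model X" using l by (simp add: w_def)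
    have "side X p q w = 0"
      using side_linear[OF p q l(3), of "1/2" "1/2" x y'] by (simp add: w_def side_reflect y'_def)
    then have "\<sigma> w = w" using fixed w by blast
    then have "quad X (w - y) = quad X (w - x)"
      using iso[OF w x] w x y by (simp add: gdist_eq_iff y_def del: bil_simps)
    also have "\<dots> = quad X (w - y')"
      using quad_reflect_right[of w x] \<open>side X p q w = 0\<close> by (simp add: y'_def del: bil_simps)
    finally have "side X y y' w = 0" by (simp add: side_def del: bil_simps)
    \<comment> \<open>The midpoint w of x and y' lies on the mirror, is fixed by \<sigma> and is
      therefore equidistant from y and y'. Hence \<open>side X y y'\<close> takes opposite values at
      x and y'. Since y' - x is parallel to p - q, it also takes equal values there, so both are
      zero.\<close>
    then have "side X y y' x + side X y y' y' = 0"
      using side_linear[OF y y' l(3), of "1/2" "1/2" x y'] l by (simp add: w_def)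
    moreover have "bil X (y' - x) (y - y') = 0"
      using 0 bil_commute[of X "y - y'" "p - q"] y'_eq by (metis add_diff_cancel_left' bil_simps(5) mult_zero_right)
    then have "side X y y' y' - side X y y' x = 0"
      unfolding side_diff by (simp only: mult_zero_right)
    ultimately have "side X y y' y' = 0" by simp
    then show ?thesis by (simp add: side_def bil_commute)
  qed
  then show ?thesis using quad_eq_0[OF y y'] by (simp add: y_def y'_def)
qed

theorem reflection_unique:
  assumes r: "is_reflection X \<sigma>" and pq': "\<sigma> p = q" and x: "x \<in> model X"
  shows "\<sigma> x = reflect X p q x"
proof -
  note r = r[unfolded is_reflection_def]
  have img: "\<sigma> ` model X = model X" using r by (elim conjE)
  have "\<forall>x\<in>model X. \<forall>y\<in>model X. gdist X (\<sigma> x) (\<sigma> y) = gdist X x y"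
    using r by (elim conjE)
  then have iso: "\<And>x y. x \<in> model X \<Longrightarrow> y \<in> model X \<Longrightarrow> gdist X (\<sigma> x) (\<sigma> y) = gdist X x y"
    by blast
  have "\<forall>x\<in>model X. \<sigma> (\<sigma> x) = x" using r by (elim conjE)
  then have inv: "\<And>x. x \<in> model X \<Longrightarrow> \<sigma> (\<sigma> x) = x" by blast
  have "\<exists>p\<in>model X. \<exists>q\<in>model X. p \<noteq> q \<and> \<sigma> ` half_space X p q = half_space X q p \<and>
        (\<forall>H\<in>{half_space X p q, half_space X q p}. \<forall>x\<in>H. \<forall>y\<in>H.
           gdist X x (\<sigma> y) \<ge> gdist X x y)"
    using r by (elim conjE)
  then obtain p' q' where p'q': "p' \<in> model X" "q' \<in> model X" "p' \<noteq> q'"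
    and sw: "\<sigma> ` half_space X p' q' = half_space X q' p'"
    and le: "\<forall>H\<in>{half_space X p' q', half_space X q' p'}. \<forall>x\<in>H. \<forall>y\<in>H. gdist X x y \<le> gdist X x (\<sigma> y)"
    by (elim bexE conjE) (rule that)
  have sw': "\<sigma> x \<in> half_space X p' q'" if "x \<in> half_space X q' p'" for x
  proof -
    from that have "x \<in> \<sigma> ` half_space X p' q'" unfolding sw .
    then obtain y where y: "y \<in> half_space X p' q'" "x = \<sigma> y" by (elim imageE)
    then have "\<sigma> x = y" using inv by (auto simp: half_space_def)
    then show ?thesis using y by simp
  qed
  have m: "mirror X p' q'" "mirror X q' p'" using p'q' by unfold_locales auto
  have "p \<in> half_space X p' q' \<or> p \<in> half_space X q' p'"
    using p by (auto simp: half_space_def)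
  then show ?thesis
  proof
    assume "p \<in> half_space X p' q'"
    then show ?thesis
      by (intro reflection_unique_aux[OF _ iso inv m(1) _ _ _ _ pq' _ x]) (use img sw sw' le in auto)
  next
    assume "p \<in> half_space X q' p'"
    then show ?thesis
      by (intro reflection_unique_aux[OF _ iso inv m(2) _ _ _ _ pq' _ x]) (use img sw sw' le in auto)
  qed
qed

end

section \<open>Reflections attached to polar parameters\<close>

lemma normal_point_in_model:
  assumes "norm (snd \<omega>) = 1"
  shows "normal_point X \<omega> \<in> model X"
proof -
  obtain r u where w: "\<omega> = (r, u)" by force
  have u: "u \<bullet> u = 1" using assms by (simp add: w norm_eq_1)
  show ?thesis
  proof (cases X)
    case Spherical
    have "norm (cos r, sin r *\<^sub>R u) = 1"
      unfolding norm_eq_1 using u by (simp add: power2_eq_square[symmetric] add.commute)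
    then show ?thesis using Spherical by (simp add: w)
  next
    case Hyperbolic
    then show ?thesis using u hyperbolic_pythagoras[of r] by (simp add: w power2_eq_square)
  qed (simp add: w)
qed

text \<open>Uniqueness replaces the Hilbert choice by an explicit formula. The dummy identity at the
  origin agrees with the degenerate value of \<open>reflect\<close> at two equal points.\<close>

lemma refl_param_eq:
  assumes \<omega>: "norm (snd \<omega>) = 1" and x: "x \<in> model X"
  shows "refl_param X \<omega> x = reflect X origin (normal_point X \<omega>) x"
proof (cases "normal_point X \<omega> = origin")
  case True
  then show ?thesis by (simp add: refl_param_def)
next
  case False
  then interpret mirror X origin "normal_point X \<omega>"
    using normal_point_in_model[OF \<omega>] by unfold_locales auto
  let ?P = "\<lambda>\<sigma>. is_reflection X \<sigma> \<and> \<sigma> origin = normal_point X \<omega>"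
  have "?P (reflect X origin (normal_point X \<omega>))"
    using is_reflection_reflect reflect_p by simp
  then have "?P (SOME \<sigma>. ?P \<sigma>)" by (rule someI[of ?P])
  then show ?thesis using reflection_unique x False by (simp add: refl_param_def)
qed

subsection \<open>Polarizations of a tent function\<close>

definition tent :: "geometry \<Rightarrow> real \<times> 'v::euclidean_space \<Rightarrow> real \<times> 'v \<Rightarrow> real" where
  "tent X a x = max (1 - gdist X x a) 0"

definition move :: "geometry \<Rightarrow> real \<times> 'v::euclidean_space \<Rightarrow> real \<times> 'v \<Rightarrow> real \<times> 'v" where
  "move X \<omega> a = (if side X origin (normal_point X \<omega>) a \<le> 0 then a
                 else reflect X origin (normal_point X \<omega>) a)"

primrec moves :: "geometry \<Rightarrow> (nat \<Rightarrow> real \<times> 'v::euclidean_space) \<Rightarrow> real \<times> 'v \<Rightarrow> nat \<Rightarrow> real \<times> 'v" where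
  "moves X \<omega> a 0 = a"
| "moves X \<omega> a (Suc n) = move X (\<omega> (Suc n)) (moves X \<omega> a n)"

lemma mirror_normal_point:
  "norm (snd \<omega>) = 1 \<Longrightarrow> normal_point X \<omega> \<noteq> origin \<Longrightarrow> mirror X origin (normal_point X \<omega>)"
  using normal_point_in_model[of \<omega> X] by unfold_locales auto

lemma move_in_model:
  assumes "norm (snd \<omega>) = 1" "a \<in> model X"
  shows "move X \<omega> a \<in> model X"
  using assms mirror.reflect_in_model[OF mirror_normal_point[OF assms(1), of X]]
  by (cases "normal_point X \<omega> = origin") (auto simp: move_def)

lemma gdist_move_le:
  assumes "norm (snd \<omega>) = 1" "a \<in> model X"
  shows "gdist X (move X \<omega> a) origin \<le> gdist X a origin"
proof (cases "normal_point X \<omega> = origin")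
  case False
  then interpret mirror X origin "normal_point X \<omega>"
    using mirror_normal_point assms by blast
  have "side X origin (normal_point X \<omega>) origin < 0" by (rule side_p)
  then show ?thesis
    using gdist_reflect_ge[OF p assms(2)]
    by (auto simp: move_def mult_le_0_iff gdist_commute[of X a] gdist_commute[of X "reflect X _ _ a"])
qed (simp add: move_def)

text \<open>The tent decreases with the distance from a, so the product of the sides of a and x
  decides which of its values at x and at the image of x is larger. If a is on the side of
  \<open>o\<close>, the maximum and the minimum return the tent itself; otherwise they return its
  composition with the reflection, which is the tent about the image of a. The function g needs to
  be a tent only on the model, so the result can be iterated.\<close>

lemma polarization_tent:
  assumes \<omega>: "norm (snd \<omega>) = 1" and a: "a \<in> model X" and x: "x \<in> model X"
    and g: "\<And>y. y \<in> model X \<Longrightarrow> g y = tent X a y"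
  shows "polarization X \<omega> g x = tent X (move X \<omega> a) x"
proof (cases "normal_point X \<omega> = origin")
  case True
  then show ?thesis
    using refl_param_eq[OF \<omega> x] g x by (simp add: polarization_def move_def)
next
  case False
  then interpret mirror X origin "normal_point X \<omega>"
    using mirror_normal_point \<omega> by blast
  let ?R = "reflect X origin (normal_point X \<omega>)" and ?s = "side X origin (normal_point X \<omega>)"
  have Rx: "?R x \<in> model X" using x by (rule reflect_in_model)
  have "gdist X x origin \<le> gdist X (?R x) origin \<longleftrightarrow> gdist X x origin \<le> gdist X x (normal_point X \<omega>)"
    using gdist_reflect_reflect[OF x q] by (simp only: reflect_q)
  also have "\<dots> \<longleftrightarrow> ?s x \<le> 0"
    using half_space_iff[of x] x by (simp add: half_space_def)
  finally have *: "polarization X \<omega> g x =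
      (if ?s x \<le> 0 then max (tent X a x) (tent X a (?R x)) else min (tent X a x) (tent X a (?R x)))"
    using refl_param_eq[OF \<omega> x] g x Rx by (simp add: polarization_def)
  have le: "tent X a (?R x) \<le> tent X a x" if "?s a * ?s x \<ge> 0"
    using gdist_reflect_le[OF a x that] by (simp add: tent_def gdist_commute[of X _ a])
  have ge: "tent X a x \<le> tent X a (?R x)" if "?s a * ?s x \<le> 0"
    using gdist_reflect_ge[OF a x that] by (simp add: tent_def gdist_commute[of X _ a])
  have swap: "tent X (?R a) x = tent X a (?R x)"
    using gdist_reflect_reflect[OF x reflect_in_model[OF a]] by (simp add: tent_def)
  show ?thesis
  proof (cases "?s a \<le> 0")
    case True
    have "?s x \<le> 0 \<Longrightarrow> 0 \<le> ?s a * ?s x" "0 \<le> ?s x \<Longrightarrow> ?s a * ?s x \<le> 0"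
      using True by (auto intro: mult_nonpos_nonpos mult_nonpos_nonneg)
    then show ?thesis using le ge True by (auto simp: * move_def)
  next
    case False
    have "?s x \<le> 0 \<Longrightarrow> ?s a * ?s x \<le> 0" "0 \<le> ?s x \<Longrightarrow> 0 \<le> ?s a * ?s x"
      using False by (auto intro: mult_nonneg_nonpos)
    then show ?thesis using le ge False by (auto simp: * move_def swap)
  qed
qed

lemma moves_in_model:
  assumes "\<And>i. i \<ge> 1 \<Longrightarrow> norm (snd (\<omega> i)) = 1" "a \<in> model X"
  shows "moves X \<omega> a n \<in> model X"
  by (induction n) (auto simp: assms move_in_model)

lemma gdist_moves_le:
  assumes "\<And>i. i \<ge> 1 \<Longrightarrow> norm (snd (\<omega> i)) = 1" "a \<in> model X"
  shows "gdist X (moves X \<omega> a n) origin \<le> gdist X a origin"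
proof (induction n)
  case (Suc n)
  have "gdist X (moves X \<omega> a (Suc n)) origin \<le> gdist X (moves X \<omega> a n) origin"
    using gdist_move_le[OF _ moves_in_model[OF assms]] assms(1) by simp
  with Suc show ?case by linarith
qed simp

lemma polarizations_tent:
  assumes "\<And>i. i \<ge> 1 \<Longrightarrow> norm (snd (\<omega> i)) = 1" "a \<in> model X" "x \<in> model X"
  shows "polarizations X \<omega> n (tent X a) x = tent X (moves X \<omega> a n) x"
  using assms(3)
proof (induction n arbitrary: x)
  case (Suc n)
  have "polarization X (\<omega> (Suc n)) (polarizations X \<omega> n (tent X a)) x
      = tent X (move X (\<omega> (Suc n)) (moves X \<omega> a n)) x"
    by (rule polarization_tent) (use Suc assms(1) moves_in_model[OF assms(1,2)] in auto)
  then show ?case by simp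
qed simp

subsection \<open>Geodesic polar coordinates\<close>

lemma normal_point_exists:
  assumes "a \<in> model X"
  obtains u where "norm u = 1" "a = normal_point X (gdist X a origin, u)"
    "X = Spherical \<Longrightarrow> gdist X a origin \<le> pi"
proof -
  obtain t v where a: "a = (t, v)" by force
  obtain e :: 'a where e: "norm e = 1" using nonempty_Basis norm_Basis by blast
  \<comment> \<open>At the poles, where v = 0, every direction is valid because its coefficient
    vanishes.\<close>
  define u where "u = (if v = 0 then e else v /\<^sub>R norm v)"
  have u: "norm u = 1" "v = norm v *\<^sub>R u" using e by (auto simp: u_def)
  show ?thesis
  proof (cases X)
    case Spherical
    have s: "t\<^sup>2 + (norm v)\<^sup>2 = 1"
      using assms model_iff[of a X] by (simp add: a Spherical power2_norm_eq_inner)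
    then have "t\<^sup>2 \<le> 1\<^sup>2" by (smt (verit) one_power2 zero_le_power2)
    then have t: "\<bar>t\<bar> \<le> 1" by (simp add: abs_square_le_1)
    have d: "gdist X a origin = arccos t" by (simp add: Spherical a origin_def)
    have "sin (arccos t) = norm v" using s t by (simp add: sin_arccos_abs real_sqrt_unique)
    then show ?thesis using that[of u] u t arccos_ubound[of t] unfolding d by (simp add: Spherical a)
  next
    case Euclidean
    have "gdist X a origin = norm v"
      using assms by (simp add: Euclidean a origin_def dist_Pair_Pair)
    then show ?thesis using that[of u] u assms by (simp add: a Euclidean)
  next
    case Hyperbolic
    have s: "t\<^sup>2 = 1 + (norm v)\<^sup>2" "t > 0"
      using assms model_iff[of a X] by (simp_all add: a Hyperbolic power2_norm_eq_inner)
    then have "1\<^sup>2 \<le> t\<^sup>2" by simp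
    then have t: "1 \<le> t" using s(2) by (metis less_eq_real_def power2_le_imp_le)
    have d: "gdist X a origin = arcosh t" by (simp add: Hyperbolic a origin_def)
    have "sinh (arcosh t) = norm v" using s t by (simp add: sinh_arcosh_real)
    then show ?thesis using that[of u] u t unfolding d by (simp add: Hyperbolic a)
  qed
qed

lemma bil_normal_point_Spherical:
  "bil Spherical (normal_point Spherical (r, u)) (normal_point Spherical (s, w))
    = cos r * cos s + sin r * sin s * (u \<bullet> w)"
  by (simp add: bil_def)

lemma bil_normal_point_Hyperbolic:
  "- bil Hyperbolic (normal_point Hyperbolic (r, u)) (normal_point Hyperbolic (s, w))
    = cosh r * cosh s - sinh r * sinh s * (u \<bullet> w)"
  by (simp add: bil_def)

lemma arcosh_cosh_abs: "arcosh (cosh x) = \<bar>x :: real\<bar>"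
  using arcosh_cosh_real[of "\<bar>x\<bar>"] by simp

text \<open>Radii may be negative, which gives the two rays of a geodesic through \<open>o\<close>
  one signed coordinate. The addition theorems turn the form into a function of r - s; on the sphere
  the bound keeps the arc between the points minimal.\<close>

lemma gdist_normal_point:
  assumes u: "norm u = 1" and "X = Spherical \<Longrightarrow> \<bar>r - s\<bar> \<le> pi"
  shows "gdist X (normal_point X (r, u)) (normal_point X (s, u)) = \<bar>r - s\<bar>"
proof (cases X)
  case Spherical
  have "cos r * cos s + sin r * sin s * (u \<bullet> u) = cos (r - s)"
    using u by (simp add: cos_diff norm_eq_1)
  then show ?thesis
    using assms by (simp only: Spherical gdist_Spherical bil_normal_point_Spherical) (simp add: arccos_cos_eq_abs)
next
  case Euclidean
  then show ?thesis using u by (simp add: dist_Pair_Pair dist_norm flip: scaleR_left_diff_distrib)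
next
  case Hyperbolic
  have "cosh r * cosh s - sinh r * sinh s * (u \<bullet> u) = cosh (r - s)"
    using u by (simp add: cosh_diff norm_eq_1)
  then show ?thesis
    by (simp only: Hyperbolic gdist_Hyperbolic bil_normal_point_Hyperbolic) (simp add: arcosh_cosh_abs)
qed

lemma normal_point_0 [simp]: "normal_point X (0, u) = origin"
  by (cases X) (simp_all add: origin_def)

lemma gdist_normal_point_origin:
  assumes "norm u = 1" and "X = Spherical \<Longrightarrow> \<bar>r\<bar> \<le> pi"
  shows "gdist X (normal_point X (r, u)) origin = \<bar>r\<bar>"
  using gdist_normal_point[of u X r 0] assms by simp

text \<open>By the law of cosines in polar coordinates the angle enters only through
  \<open>u \<bullet> w\<close>, which lies between -1 and 1. The extreme values are those of
  collinear positions, where the distance is |r - s| or, up to wrapping around the sphere, r +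
  s.\<close>

lemma gdist_triangle_origin:
  assumes x: "x \<in> model X" and a: "a \<in> model X"
  shows "\<bar>gdist X x a - gdist X x origin\<bar> \<le> gdist X a origin"
proof -
  define r where "r = gdist X x origin"
  define s where "s = gdist X a origin"
  obtain u where u: "norm u = 1" "x = normal_point X (r, u)" "X = Spherical \<Longrightarrow> r \<le> pi"
    using normal_point_exists[OF x] unfolding r_def by blast
  obtain w where w: "norm w = 1" "a = normal_point X (s, w)" "X = Spherical \<Longrightarrow> s \<le> pi"
    using normal_point_exists[OF a] unfolding s_def by blast
  have rs: "0 \<le> r" "0 \<le> s" unfolding r_def s_def using x a by (auto intro: gdist_nonneg)
  have uw: "\<bar>u \<bullet> w\<bar> \<le> 1" using Cauchy_Schwarz_ineq2[of u w] u w by simp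
  have "\<bar>r - s\<bar> \<le> gdist X x a \<and> gdist X x a \<le> r + s"
  proof (cases X)
    case Spherical
    then have pi: "r \<le> pi" "s \<le> pi" using u w by auto
    then have "0 \<le> sin r * sin s" using rs by (intro mult_nonneg_nonneg sin_ge_zero) auto
    then have *: "\<bar>sin r * sin s * (u \<bullet> w)\<bar> \<le> sin r * sin s"
      using uw by (metis abs_mult abs_of_nonneg mult.right_neutral mult_left_mono)
    have b: "\<bar>bil X x a\<bar> \<le> 1" using bil_Spherical_bound x a Spherical by blast
    have eq: "bil X x a = cos r * cos s + sin r * sin s * (u \<bullet> w)"
      unfolding u(2) w(2) unfolding Spherical by (rule bil_normal_point_Spherical)
    have le: "bil X x a \<le> cos (r - s)" "cos (r + s) \<le> bil X x a"
      using * unfolding eq cos_diff cos_add by linarith+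
    have "arccos (cos (r - s)) \<le> arccos (bil X x a)"
      using le b by (intro arccos_le_arccos) auto
    moreover have "arccos (cos (r - s)) = \<bar>r - s\<bar>"
      using pi rs by (intro arccos_cos_eq_abs) linarith
    moreover have "arccos (bil X x a) \<le> r + s"
    proof (cases "r + s \<le> pi")
      case True
      have "arccos (bil X x a) \<le> arccos (cos (r + s))"
        using le b by (intro arccos_le_arccos) auto
      then show ?thesis using True rs by (simp add: arccos_cos)
    next
      case False
      then show ?thesis using b arccos_ubound[of "bil X x a"] by linarith
    qed
    ultimately show ?thesis by (simp only: Spherical gdist_Spherical)
  next
    case Euclidean
    show ?thesis unfolding r_def s_def Euclidean
      using dist_triangle3[of a origin x] dist_triangle[of x origin a] dist_triangle2[of x a origin]
      by (simp add: abs_diff_le_iff)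
  next
    case Hyperbolic
    have "0 \<le> sinh r * sinh s" using rs by simp
    then have *: "\<bar>sinh r * sinh s * (u \<bullet> w)\<bar> \<le> sinh r * sinh s"
      using uw by (metis abs_mult abs_of_nonneg mult.right_neutral mult_left_mono)
    have eq: "- bil X x a = cosh r * cosh s - sinh r * sinh s * (u \<bullet> w)"
      unfolding u(2) w(2) unfolding Hyperbolic by (rule bil_normal_point_Hyperbolic)
    have le: "cosh (r - s) \<le> - bil X x a" "- bil X x a \<le> cosh (r + s)"
      using * unfolding eq cosh_diff cosh_add by linarith+
    have ge1: "1 \<le> - bil X x a" using le(1) cosh_real_ge_1[of "r - s"] by linarith
    have mono: "arcosh y \<le> arcosh z" if "1 \<le> y" "y \<le> z" for y z :: real
      using that by (cases "y = z") (auto intro: less_imp_le)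
    have "arcosh (cosh (r - s)) \<le> arcosh (- bil X x a)"
      by (rule mono[OF cosh_real_ge_1 le(1)])
    moreover have "arcosh (- bil X x a) \<le> arcosh (cosh (r + s))"
      by (rule mono[OF ge1 le(2)])
    ultimately show ?thesis using rs
      by (simp only: Hyperbolic gdist_Hyperbolic) (simp add: arcosh_cosh_abs)
  qed
  then show ?thesis unfolding r_def[symmetric] s_def[symmetric] by linarith
qed

text \<open>The supremum is attained at \<open>o\<close>, where the bound by 1 keeps the outer tent
  from being cut off. It is no larger because cutting off at 0 is a contraction and the triangle
  inequality holds.\<close>

lemma sup_norm_tent_diff:
  assumes a: "a \<in> model X" and le: "gdist X a origin \<le> 1"
  shows "sup_norm X (\<lambda>x. tent X a x - tent X origin x) = gdist X a origin"
  unfolding sup_norm_def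
proof (rule cSup_eq_maximum)
  have "gdist X a origin = \<bar>tent X a origin - tent X origin origin\<bar>"
    using le gdist_nonneg[OF a origin_in_model] gdist_commute[of X origin a]
    by (simp add: tent_def gdist_self)
  then show "gdist X a origin \<in> (\<lambda>x. \<bar>tent X a x - tent X origin x\<bar>) ` model X"
    using origin_in_model by blast
next
  fix y assume "y \<in> (\<lambda>x. \<bar>tent X a x - tent X origin x\<bar>) ` model X"
  then obtain x where x: "x \<in> model X" "y = \<bar>tent X a x - tent X origin x\<bar>" by blast
  have "\<bar>max (1 - s) 0 - max (1 - t) 0\<bar> \<le> \<bar>s - t\<bar>" for s t :: real by (auto simp: max_def)
  then have "y \<le> \<bar>gdist X x a - gdist X x origin\<bar>" unfolding x(2) tent_def .
  then show "y \<le> gdist X a origin" using gdist_triangle_origin[OF x(1) a] by linarith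
qed

lemma sup_norm_cong: "(\<And>x. x \<in> model X \<Longrightarrow> g x = h x) \<Longrightarrow> sup_norm X g = sup_norm X h"
  unfolding sup_norm_def by (rule SUP_cong) auto

section \<open>Which parameters move a point, and where to\<close>

text \<open>In the expansion of \<open>side\<close> about \<open>o\<close>, every term except the
  inner product of the spatial parts is nonpositive as long as \<open>0 \<le> fst z\<close>. Below
  the equator of the sphere this fails: the antipode of \<open>o\<close> is moved by every
  reflection that moves \<open>o\<close>.\<close>

lemma side_pos_imp_inner_pos:
  assumes p: "p \<in> model X" and z: "z \<in> model X" "0 \<le> fst z" and pos: "0 < side X origin p z"
  shows "0 < snd p \<bullet> snd z"
proof -
  have eq: "side X origin p z =
      curv X - quad X p + 2 * (snd p \<bullet> snd z) - 2 * curv X * (fst z * (1 - fst p))"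
    unfolding side_eq by (simp add: bil_def origin_def algebra_simps inner_commute)
  show ?thesis
  proof (cases "X = Euclidean")
    case True
    have "0 \<le> quad X p" by (simp add: True bil_def)
    then show ?thesis using pos eq True by simp
  next
    case False
    have "0 \<le> curv X * (1 - fst p)"
    proof (cases X)
      case Spherical
      have "(fst p)\<^sup>2 + snd p \<bullet> snd p = 1" using p model_iff[of p X] Spherical by simp
      then have "(fst p)\<^sup>2 \<le> 1" using inner_ge_zero[of "snd p"] by linarith
      then have "\<bar>fst p\<bar> \<le> 1" by (simp add: abs_square_le_1)
      then show ?thesis using Spherical by simp
    next
      case Hyperbolic
      have "(fst p)\<^sup>2 = 1 + snd p \<bullet> snd p" "0 < fst p"
        using p model_iff[of p X] Hyperbolic by auto
      then have "1 \<le> (fst p)\<^sup>2" "0 < fst p" using inner_ge_zero[of "snd p"] by linarith+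
      then have "1 \<le> fst p" by (metis less_eq_real_def one_power2 power2_le_imp_le)
      then show ?thesis using Hyperbolic by simp
    qed (use False in simp)
    then have "0 \<le> curv X * (fst z * (1 - fst p))"
      using z(2) by (metis mult.left_commute mult_nonneg_nonneg)
    then show ?thesis using pos eq quad_model[OF p False] by linarith
  qed
qed

lemma normal_point_uminus: "normal_point X (r, - u) = normal_point X (- r, u)"
  by (cases X) simp_all

lemma normal_point_signed: "b = 1 \<or> b = -1 \<Longrightarrow> normal_point X (r, b *\<^sub>R u) = normal_point X (b * r, u)"
  by (auto simp: normal_point_uminus)

text \<open>On the geodesic through \<open>o\<close> in direction u, the reflection exchanges the
  signed coordinates 0 and r, so it has to be s \<mapsto> r - s. The identities checked below
  express this through the addition theorems.\<close>

lemma reflect_normal_point: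
  assumes u: "norm u = 1" and r: "0 < r" "X = Spherical \<Longrightarrow> r \<le> pi"
  shows "reflect X origin (normal_point X (r, u)) (normal_point X (s, u)) = normal_point X (r - s, u)"
proof -
  let ?p = "normal_point X (r, u)" and ?z = "normal_point X (s, u)"
  have uu: "u \<bullet> u = 1" using u by (simp add: norm_eq_1)
  have m: "?p \<in> model X" "?z \<in> model X" using normal_point_in_model u by auto
  have quad: "quad X (origin - ?p) = 2 * curv X - 2 * bil X origin ?p" if "X \<noteq> Euclidean"
    using quad_diff[OF that origin_in_model m(1)] .
  have side: "side X origin ?p ?z = 2 * bil X ?z ?p - 2 * bil X ?z origin" if "X \<noteq> Euclidean"
    using quad_model[OF origin_in_model that] quad_model[OF m(1) that] by (simp add: side_eq)
  show ?thesis
  proof (cases X)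
    case Spherical
    have lt: "cos r < 1" using cos_monotone_0_pi[of 0 r] r Spherical by simp
    have N: "quad X (origin - ?p) = 2 * (1 - cos r)"
      using quad by (simp add: Spherical bil_def origin_def)
    have S: "side X origin ?p ?z = 2 * (cos (s - r) - cos s)"
      using side by (simp add: Spherical bil_def origin_def uu cos_diff algebra_simps)
    have q: "side X origin ?p ?z / quad X (origin - ?p) = (cos (s - r) - cos s) / (1 - cos r)"
      unfolding N S by (rule mult_divide_mult_cancel_left) simp
    have "(cos (s - r) - cos s) * sin r - (1 - cos r) * (sin s - sin (r - s))
        = sin s * ((sin r)\<^sup>2 + (cos r)\<^sup>2 - 1)"
      unfolding cos_diff sin_diff by algebra
    then have "(cos (s - r) - cos s) * sin r = (1 - cos r) * (sin s - sin (r - s))"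
      by simp
    then have "(cos (s - r) - cos s) / (1 - cos r) * sin r = sin s - sin (r - s)"
      using lt by (simp add: field_simps)
    moreover have "(cos (s - r) - cos s) / (1 - cos r) * (1 - cos r) = cos (r - s) - cos s"
      using lt cos_minus[of "r - s"] by simp
    ultimately show ?thesis
      unfolding reflect_def q
      by (simp add: Spherical origin_def algebra_simps flip: scaleR_left_diff_distrib)
  next
    case Euclidean
    have N: "quad X (origin - ?p) = r\<^sup>2"
      by (simp add: Euclidean bil_def origin_def uu power2_eq_square)
    have S: "side X origin ?p ?z = (2 * s - r) * r"
      by (simp add: side_eq Euclidean bil_def origin_def uu power2_eq_square algebra_simps)
    have "side X origin ?p ?z / quad X (origin - ?p) = (2 * s - r) / r"
      unfolding N S using r by (simp add: power2_eq_square)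
    then show ?thesis using r
      by (simp add: reflect_def Euclidean origin_def flip: scaleR_left_diff_distrib)
  next
    case Hyperbolic
    have gt: "cosh r > 1" using r cosh_real_strict_mono[of 0 r] by simp
    have N: "quad X (origin - ?p) = 2 * (cosh r - 1)"
      using quad by (simp add: Hyperbolic bil_def origin_def)
    have S: "side X origin ?p ?z = 2 * (cosh s - cosh (s - r))"
      using side by (simp add: Hyperbolic bil_def origin_def uu cosh_diff algebra_simps)
    have q: "side X origin ?p ?z / quad X (origin - ?p) = (cosh s - cosh (s - r)) / (cosh r - 1)"
      unfolding N S by (rule mult_divide_mult_cancel_left) simp
    have "(cosh s - cosh (s - r)) * sinh r - (cosh r - 1) * (sinh s - sinh (r - s))
        = sinh s * ((sinh r)\<^sup>2 - (cosh r)\<^sup>2 + 1)"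
      unfolding cosh_diff sinh_diff by algebra
    then have "(cosh s - cosh (s - r)) * sinh r = (cosh r - 1) * (sinh s - sinh (r - s))"
      by (simp add: sinh_square_eq)
    then have "(cosh s - cosh (s - r)) / (cosh r - 1) * sinh r = sinh s - sinh (r - s)"
      using gt r by simp
    moreover have "(cosh s - cosh (s - r)) / (cosh r - 1) * (1 - cosh r) = cosh (r - s) - cosh s"
    proof -
      have "x / d * (- d) = - x" if "d \<noteq> 0" for x d :: real using that by simp
      from this[of "cosh r - 1" "cosh s - cosh (s - r)"] show ?thesis
        using gt cosh_minus[of "r - s"] by (simp only: minus_diff_eq)
    qed
    ultimately show ?thesis
      unfolding reflect_def q
      by (simp add: Hyperbolic origin_def algebra_simps flip: scaleR_left_diff_distrib)
  qed
qed

text \<open>The point lands on the opposite ray at distance s - r from \<open>o\<close>: the loss of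
  distance is r, which may be chosen as small as desired.\<close>

lemma move_jump:
  assumes u: "norm u = 1" and r: "0 < r" "r \<le> s" "X = Spherical \<Longrightarrow> s \<le> pi"
  shows "move X (r, u) (normal_point X (s, u)) = normal_point X (r - s, u)"
proof -
  have m: "normal_point X (r, u) \<in> model X" "normal_point X (s, u) \<in> model X"
    using normal_point_in_model u by auto
  have "gdist X (normal_point X (s, u)) (normal_point X (r, u)) < gdist X (normal_point X (s, u)) origin"
    using r u by (subst gdist_normal_point, simp, force) (subst gdist_normal_point_origin, auto)
  then have "0 < side X origin (normal_point X (r, u)) (normal_point X (s, u))"
    using m by (simp add: gdist_less_iff side_def del: bil_simps)
  then show ?thesis
    using reflect_normal_point[OF u r(1), of X s] r by (force simp: move_def)
qed

text \<open>Since 1 < \<pi>/2, the cosine is nonnegative and the sine has the sign of its argument.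
  For nonzero s the factor k is sin s / s, 1 or sinh s / s.\<close>

lemma normal_point_small:
  assumes "norm u = 1" "\<bar>s\<bar> \<le> 1"
  shows "0 \<le> fst (normal_point X (s, u))"
    and "\<exists>k\<ge>0. snd (normal_point X (s, u)) = (k * s) *\<^sub>R u"
proof -
  show "0 \<le> fst (normal_point X (s, u))"
    using assms pi_gt3 by (cases X) (auto intro!: cos_ge_zero)
  have nn: "\<exists>k\<ge>0. S = k * s" if "0 \<le> S * s" "s = 0 \<Longrightarrow> S = 0" for S :: real
  proof (cases "s = 0")
    case False
    then have "S / s * s = S" "0 \<le> S / s" using that by (auto simp: zero_le_divide_iff zero_le_mult_iff)
    then show ?thesis by metis
  qed (use that in auto)
  have "0 \<le> sin s * s"
  proof (cases "0 \<le> s")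
    case True
    then show ?thesis using assms pi_gt3 by (intro mult_nonneg_nonneg sin_ge_zero) auto
  next
    case False
    then have "0 \<le> sin (- s)" using assms pi_gt3 by (intro sin_ge_zero) auto
    then show ?thesis using False by (simp add: mult_nonpos_nonpos)
  qed
  then obtain k where k: "k \<ge> 0" "sin s = k * s" using nn by force
  have "0 \<le> sinh s * s" by (cases "0 \<le> s") (auto simp: mult_nonpos_nonpos)
  then obtain k' where k': "k' \<ge> 0" "sinh s = k' * s" using nn by force
  show "\<exists>k\<ge>0. snd (normal_point X (s, u)) = (k * s) *\<^sub>R u"
    by (cases X) (use k k' in \<open>auto intro: exI[of _ 1]\<close>)
qed

lemma normal_point_snd_nonneg:
  assumes "0 \<le> r" "X = Spherical \<Longrightarrow> r \<le> pi"
  shows "\<exists>k\<ge>0. snd (normal_point X (r, v)) = k *\<^sub>R v"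
  using assms by (cases X) (auto intro: exI[of _ r] exI[of _ "sin r"] exI[of _ "sinh r"] sin_ge_zero)

text \<open>Up to a nonnegative factor, \<open>s * (u \<bullet> v)\<close> is the inner product of
  the spatial parts, so the point cannot be moved when it is nonpositive. For each direction v at
  least one of v and -v qualifies.\<close>

lemma move_stay:
  assumes u: "norm u = 1" and v: "norm v = 1" and s: "\<bar>s\<bar> \<le> 1"
    and r: "0 \<le> r" "X = Spherical \<Longrightarrow> r \<le> pi" and le: "s * (u \<bullet> v) \<le> 0"
  shows "move X (r, v) (normal_point X (s, u)) = normal_point X (s, u)"
proof -
  obtain k where k: "k \<ge> 0" "snd (normal_point X (s, u)) = (k * s) *\<^sub>R u"
    using normal_point_small[OF u s] by blast
  obtain k' where k': "k' \<ge> 0" "snd (normal_point X (r, v)) = k' *\<^sub>R v"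
    using normal_point_snd_nonneg[OF r] by blast
  have "snd (normal_point X (r, v)) \<bullet> snd (normal_point X (s, u)) = (k' * k) * (s * (u \<bullet> v))"
    unfolding k k' by (simp add: inner_commute)
  also have "\<dots> \<le> 0" using k(1) k'(1) by (intro mult_nonneg_nonpos le) simp
  finally have "\<not> 0 < side X origin (normal_point X (r, v)) (normal_point X (s, u))"
    using side_pos_imp_inner_pos[of "normal_point X (r, v)" X "normal_point X (s, u)"]
      normal_point_in_model[of _ X] normal_point_small(1)[OF u s] u v by force
  then show ?thesis by (simp add: move_def)
qed

section \<open>Dense sequences of parameters and a divergent orbit\<close>

lemma Omega_used_iff:
  "\<omega> \<in> Omega_used X \<longleftrightarrow> 0 \<le> fst \<omega> \<and> (X = Spherical \<longrightarrow> fst \<omega> \<le> pi) \<and> norm (snd \<omega>) = 1"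
  by (cases \<omega>) (auto simp: Omega_used_def Omega_def)

text \<open>Only parameters with positive radius are admissible for polarizations; those of radius 0
  are limits along radii 1/(n+1).\<close>

lemma Omega_used_dense_sequence:
  obtains T :: "nat \<Rightarrow> real \<times> 'v::euclidean_space"
  where "\<And>k. T k \<in> Omega_used X" "\<And>k. 0 < fst (T k)" "Omega_used X \<subseteq> closure (range T)"
proof -
  define D where "D = {\<omega> :: real \<times> 'v. \<omega> \<in> Omega_used X \<and> 0 < fst \<omega>}"
  obtain C where C: "countable C" "C \<subseteq> D" "D \<subseteq> closure C"
    using separable by blast
  obtain e :: 'v where "norm e = 1" using nonempty_Basis norm_Basis by blast
  then have "(1, e) \<in> D" using pi_gt3 by (auto simp: D_def Omega_used_iff)
  then have "C \<noteq> {}" using C by auto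
  then have rng: "range (from_nat_into C) = C" using C(1) by (rule range_from_nat_into)
  have "Omega_used X \<subseteq> closure D"
  proof
    fix \<omega> :: "real \<times> 'v" assume \<omega>: "\<omega> \<in> Omega_used X"
    show "\<omega> \<in> closure D"
    proof (cases "fst \<omega> = 0")
      case False
      then have "\<omega> \<in> D" using \<omega> by (auto simp: D_def Omega_used_iff)
      then show ?thesis using closure_subset by blast
    next
      case True
      have "(\<lambda>n. (1 / real (Suc n), snd \<omega>)) \<longlonglongrightarrow> (0, snd \<omega>)"
        by (intro tendsto_Pair tendsto_const LIMSEQ_Suc[OF lim_1_over_n])
      moreover have "(1 / real (Suc n), snd \<omega>) \<in> D" for n
      proof -
        have "1 / real (Suc n) \<le> 1" by simp
        then have "1 / real (Suc n) \<le> pi" using pi_gt3 by linarith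
        then show ?thesis using \<omega> by (auto simp: D_def Omega_used_iff)
      qed
      ultimately show ?thesis
        using True unfolding closure_sequential by (metis prod.collapse)
    qed
  qed
  also have "\<dots> \<subseteq> closure C" using C(3) closure_minimal closed_closure by blast
  finally have "Omega_used X \<subseteq> closure (range (from_nat_into C))" using rng by simp
  moreover have "from_nat_into C k \<in> D" for k using rng C(2) by blast
  ultimately show ?thesis using that[of "from_nat_into C"] by (simp add: D_def)
qed

text \<open>The point is thrown back and forth across \<open>o\<close>, at decreasing distances \<open>rad j\<close> that stay above a
  positive bound. The jumps alternate with the terms of a dense sequence of parameters; if such a term
  would move the point, then its opposite \<open>(r, -v)\<close> does not, and is used instead. Each term is tried
  on both sides of \<open>o\<close>, so that it is used unchanged at least once.\<close>

theorem exists_dense_divergent_polarizations: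
  fixes a :: "real \<times> 'v::euclidean_space"
  assumes a: "a \<in> model X" "a \<noteq> origin"
  obtains \<omega> x where "\<And>i. i \<ge> 1 \<Longrightarrow> \<omega> i \<in> Omega_used X \<and> fst (\<omega> i) > 0"
    "Omega_used X \<subseteq> closure (\<omega> ` {1..})" "x \<in> model X"
    "\<not> convergent (\<lambda>n. polarizations X \<omega> n (tent X a) x)"
proof -
  define \<rho> where "\<rho> = gdist X a origin"
  obtain u where u: "norm u = 1" "a = normal_point X (\<rho>, u)" "X = Spherical \<Longrightarrow> \<rho> \<le> pi"
    using normal_point_exists[OF a(1)] unfolding \<rho>_def by blast
  have \<rho>: "0 < \<rho>" using gdist_nonneg[OF a(1) origin_in_model] gdist_eq_0_iff[OF a(1) origin_in_model] a(2)
    by (simp add: \<rho>_def)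
  \<comment> \<open>The cap at 1 keeps all positions after the first jump in the range where
    \<open>move_stay\<close> applies.\<close>
  define c where "c = min \<rho> 1"
  have c: "0 < c" "c \<le> 1" "c \<le> \<rho>" using \<rho> by (auto simp: c_def)
  \<comment> \<open>The initial position may be far from \<open>o\<close>, but no parameter of the
    dense sequence is used there. From j = 1 on the radii stay between c/2 and c and decrease to
    c/2.\<close>
  define rad where "rad j = (if j = 0 then \<rho> else c * (1 + (1/2) ^ j) / 2)" for j :: nat
  define sg :: "nat \<Rightarrow> real" where "sg j = (- 1) ^ j" for j
  have sg: "sg j = 1 \<or> sg j = - 1" "sg (Suc j) = - sg j" "\<bar>sg j\<bar> = 1" "sg j * sg j = 1" for j
    by (auto simp: sg_def minus_one_power_iff)
  define pos where "pos j = normal_point X (sg j * rad j, u)" for j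
  have pos_in: "pos j \<in> model X" for j using normal_point_in_model[of "(_, u)"] u by (simp add: pos_def)
  have rad_less: "rad (Suc j) < rad j" for j
  proof (cases "j = 0")
    case False
    have "(1/2 :: real) ^ Suc j < (1/2) ^ j" by simp
    then show ?thesis using False c(1) by (simp add: rad_def)
  qed (use c in \<open>simp add: rad_def\<close>)
  have rad_le: "rad (Suc j) \<le> c" for j
  proof -
    have "(1/2 :: real) ^ Suc j \<le> 1" by (rule power_le_one) auto
    then have "c * (1 + (1/2) ^ Suc j) \<le> c * 2" using c by (intro mult_left_mono) auto
    then show ?thesis by (simp add: rad_def)
  qed
  have rad_ge: "c / 2 \<le> rad j" for j
    using c by (auto simp: rad_def field_simps)
  have rad_pi: "rad j \<le> pi" if "X = Spherical" for j
  proof -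
    have "rad j \<le> rad 0" by (rule lift_Suc_antimono_le[of rad]) (use rad_less in \<open>auto intro: less_imp_le\<close>)
    then have "rad j \<le> \<rho>" by (simp add: rad_def)
    then show ?thesis using u(3)[OF that] by simp
  qed
  obtain T :: "nat \<Rightarrow> real \<times> 'v" where T: "\<And>k. T k \<in> Omega_used X" "\<And>k. 0 < fst (T k)"
      "Omega_used X \<subseteq> closure (range T)"
    by (rule Omega_used_dense_sequence[where X = X]) blast
  define jump where "jump j = (rad j - rad (Suc j), sg j *\<^sub>R u)" for j
  \<comment> \<open>Halving the index offers the same term at two consecutive j. Trial j is made
    after jump j, at \<open>pos (Suc j)\<close>, hence the shifted sign.\<close>
  define trial where "trial j = (let q = T (j div 2) in
      if sg (Suc j) * (u \<bullet> snd q) \<le> 0 then q else (fst q, - snd q))" for j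
  \<comment> \<open>Steps are counted from 1: step 2 j + 1 is jump j and step 2 j + 2 is trial
    j.\<close>
  define \<omega> where "\<omega> n = (if odd n then jump (n div 2) else trial (n div 2 - 1))" for n
  have \<omega>_odd: "\<omega> (Suc (2 * j)) = jump j" and \<omega>_even: "\<omega> (Suc (Suc (2 * j))) = trial j" for j
    by (simp_all add: \<omega>_def)
  have trial_used: "trial j \<in> Omega_used X" "0 < fst (trial j)" for j
    using T(1,2)[of "j div 2"] by (auto simp: trial_def Let_def Omega_used_iff)
  have jump_used: "jump j \<in> Omega_used X" "0 < fst (jump j)" for j
  proof -
    show "0 < fst (jump j)" using rad_less[of j] by (simp add: jump_def)
    moreover have "rad j - rad (Suc j) \<le> pi" if "X = Spherical"
      using rad_pi[OF that, of j] rad_ge[of "Suc j"] c by linarith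
    ultimately show "jump j \<in> Omega_used X" using u sg(3)[of j] by (simp add: Omega_used_iff jump_def)
  qed
  have \<omega>_used: "\<omega> i \<in> Omega_used X \<and> 0 < fst (\<omega> i)" for i
    using trial_used jump_used by (auto simp: \<omega>_def)
  have move_jump: "move X (jump j) (pos j) = pos (Suc j)" for j
  proof -
    have "pos j = normal_point X (rad j, sg j *\<^sub>R u)"
      unfolding pos_def by (rule normal_point_signed[OF sg(1), symmetric])
    moreover have "move X (jump j) (normal_point X (rad j, sg j *\<^sub>R u))
        = normal_point X (rad j - rad (Suc j) - rad j, sg j *\<^sub>R u)"
      unfolding jump_def
      using u sg(3)[of j] rad_less[of j] rad_pi[of j] rad_ge[of "Suc j"] c
      by (intro move_jump) auto
    moreover have "normal_point X (rad j - rad (Suc j) - rad j, sg j *\<^sub>R u) = pos (Suc j)"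
      by (subst normal_point_signed[OF sg(1)]) (simp add: pos_def sg(2))
    ultimately show ?thesis by simp
  qed
  have move_trial: "move X (trial j) (pos (Suc j)) = pos (Suc j)" for j
  proof -
    have le: "sg (Suc j) * (u \<bullet> snd (trial j)) \<le> 0" by (auto simp: trial_def Let_def)
    have "\<bar>sg (Suc j) * rad (Suc j)\<bar> \<le> 1"
      using rad_le[of j] rad_ge[of "Suc j"] c by (simp add: abs_mult sg(3))
    moreover have "sg (Suc j) * rad (Suc j) * (u \<bullet> snd (trial j)) \<le> 0"
      using mult_nonneg_nonpos[OF _ le, of "rad (Suc j)"] rad_ge[of "Suc j"] c by (simp add: mult_ac)
    ultimately have "move X (fst (trial j), snd (trial j)) (pos (Suc j)) = pos (Suc j)"
      unfolding pos_def using trial_used[of j] u by (intro move_stay) (auto simp: Omega_used_iff)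
    then show ?thesis by simp
  qed
  have moves_even: "moves X \<omega> a (2 * j) = pos j" for j
  proof (induction j)
    case 0
    then show ?case using u by (simp add: pos_def sg_def rad_def)
  next
    case (Suc j)
    then show ?case by (simp add: \<omega>_odd \<omega>_even move_jump move_trial)
  qed
  \<comment> \<open>The test point is the limit of the positions on the positive ray. Positions with
    even index come within c/2 of x, those with odd index stay at distance at least c, so the tents
    at x are separated by the gap between 1 - c/2 and 1 - c.\<close>
  define x where "x = normal_point X (c / 2, u)"
  have x: "x \<in> model X" using normal_point_in_model[of "(_, u)"] u by (simp add: x_def)
  have tent_pos: "tent X (pos j) x = max (1 - \<bar>c / 2 - sg j * rad j\<bar>) 0" if "j \<ge> 1" for j
  proof -
    have "rad j \<le> c" using rad_le[of "j - 1"] that by simp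
    then have "\<bar>c / 2 - sg j * rad j\<bar> \<le> 2" using sg(1)[of j] rad_ge[of j] c by (auto simp: abs_if)
    then have "gdist X x (pos j) = \<bar>c / 2 - sg j * rad j\<bar>"
      unfolding x_def pos_def using u pi_gt3 by (intro gdist_normal_point) auto
    then show ?thesis by (simp add: tent_def)
  qed
  have S: "polarizations X \<omega> (2 * j) (tent X a) x = tent X (pos j) x" for j
    using polarizations_tent[of \<omega> a X x "2 * j"] a x \<omega>_used moves_even by (simp add: Omega_used_iff)
  have "\<not> convergent (\<lambda>n. polarizations X \<omega> n (tent X a) x)"
  proof
    assume "convergent (\<lambda>n. polarizations X \<omega> n (tent X a) x)"
    then obtain L where L: "(\<lambda>n. polarizations X \<omega> n (tent X a) x) \<longlonglongrightarrow> L"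
      by (auto simp: convergent_def)
    have "strict_mono (\<lambda>j::nat. 2 * j)" by (auto simp: strict_mono_def)
    from LIMSEQ_subseq_LIMSEQ[OF L this] have L': "(\<lambda>j. tent X (pos j) x) \<longlonglongrightarrow> L"
      by (simp add: o_def S)
    have "strict_mono (\<lambda>j::nat. 2 * Suc j)" "strict_mono (\<lambda>j::nat. Suc (2 * j))" by (auto simp: strict_mono_def)
    then have lim: "(\<lambda>j. tent X (pos (2 * Suc j)) x) \<longlonglongrightarrow> L" "(\<lambda>j. tent X (pos (Suc (2 * j))) x) \<longlonglongrightarrow> L"
      using L' by (auto dest: LIMSEQ_subseq_LIMSEQ simp: o_def)
    have "1 - c / 2 \<le> L"
    proof (rule LIMSEQ_le_const[OF lim(1)], intro exI allI impI)
      fix j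
      have "\<bar>c / 2 - sg (2 * Suc j) * rad (2 * Suc j)\<bar> \<le> c / 2"
        using rad_le[of "Suc (2 * j)"] rad_ge[of "2 * Suc j"] by (simp add: sg_def)
      then show "1 - c / 2 \<le> tent X (pos (2 * Suc j)) x" by (subst tent_pos) (auto simp: le_max_iff_disj)
    qed
    moreover have "L \<le> 1 - c"
    proof (rule LIMSEQ_le_const2[OF lim(2)], intro exI allI impI)
      fix j
      have "c \<le> \<bar>c / 2 - sg (Suc (2 * j)) * rad (Suc (2 * j))\<bar>"
        using rad_ge[of "Suc (2 * j)"] by (simp add: sg_def)
      then show "tent X (pos (Suc (2 * j))) x \<le> 1 - c" using tent_pos[of "Suc (2 * j)"] c by simp
    qed
    ultimately show False using c by linarith
  qed
  moreover have "range T \<subseteq> \<omega> ` {1..}"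
  proof
    fix q assume "q \<in> range T"
    then obtain k where k: "q = T k" by blast
    have "\<exists>j. j div 2 = k \<and> sg (Suc j) * (u \<bullet> snd q) \<le> 0"
    proof (cases "u \<bullet> snd q \<le> 0")
      case True
      then show ?thesis by (intro exI[of _ "Suc (2 * k)"]) (simp add: sg_def)
    next
      case False
      then show ?thesis by (intro exI[of _ "2 * k"]) (simp add: sg_def)
    qed
    then obtain j where "j div 2 = k" "sg (Suc j) * (u \<bullet> snd q) \<le> 0" by blast
    then have "trial j = q" by (simp add: trial_def k)
    then show "q \<in> \<omega> ` {1..}" using \<omega>_even[of j] by (metis atLeast_iff image_eqI le_add1 plus_1_eq_Suc)
  qed
  then have "Omega_used X \<subseteq> closure (\<omega> ` {1..})" using T(3) closure_mono by blast
  ultimately show ?thesis using that \<omega>_used x by blast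
qed

subsection \<open>Volumes of balls\<close>

lemma nn_integral_lborel_affine:
  fixes f :: "'a::euclidean_space \<Rightarrow> ennreal"
  assumes [measurable]: "f \<in> borel_measurable borel" and c: "c \<noteq> 0"
  shows "(\<integral>\<^sup>+x. f x \<partial>lborel) = ennreal (\<bar>c\<bar> ^ DIM('a)) * (\<integral>\<^sup>+x. f (t + c *\<^sub>R x) \<partial>lborel)"
proof -
  have "(\<integral>\<^sup>+x. f x \<partial>lborel)
      = (\<integral>\<^sup>+x. f x \<partial>(density (distr lborel borel (\<lambda>x. t + c *\<^sub>R x)) (\<lambda>_. ennreal (\<bar>c\<bar> ^ DIM('a)))))"
    using lborel_affine[OF c, of t] by simp
  also have "\<dots> = ennreal (\<bar>c\<bar> ^ DIM('a)) * (\<integral>\<^sup>+x. f (t + c *\<^sub>R x) \<partial>lborel)"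
    by (simp add: nn_integral_density nn_integral_distr nn_integral_cmult)
  finally show ?thesis .
qed

lemma borel_measurable_linear:
  fixes L :: "'a::euclidean_space \<Rightarrow> 'b::euclidean_space"
  shows "linear L \<Longrightarrow> L \<in> borel_measurable borel"
  by (intro borel_measurable_continuous_onI linear_continuous_on linear_conv_bounded_linear[THEN iffD1])

text \<open>Weil's argument for the uniqueness of translation invariant measures, applied to the image of the
  Lebesgue measure under \<open>L\<close>.\<close>

lemma emeasure_linear_involution_aux:
  fixes L :: "'a::euclidean_space \<Rightarrow> 'a"
  assumes L: "linear L" "\<And>x. L (L x) = x" and A[measurable]: "A \<in> sets borel" and B[measurable]: "B \<in> sets borel"
  shows "emeasure lborel (L -` A) * emeasure lborel B = emeasure lborel A * emeasure lborel (L -` B)"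
proof -
  have [measurable]: "L \<in> borel_measurable borel" using L(1) by (rule borel_measurable_linear)
  have pre: "emeasure lborel (L -` S) = (\<integral>\<^sup>+x. indicator S (L x) \<partial>lborel)" if [measurable]: "S \<in> sets borel" for S
  proof -
    have "L -` S \<in> sets borel" using measurable_sets_borel[of L borel S] by simp
    then have "emeasure lborel (L -` S) = (\<integral>\<^sup>+x. indicator (L -` S) x \<partial>lborel)"
      by simp
    then show ?thesis by (simp add: indicator_def)
  qed
  have "emeasure lborel (L -` A) * emeasure lborel B
      = (\<integral>\<^sup>+x. indicator A (L x) * (\<integral>\<^sup>+y. indicator B y \<partial>lborel) \<partial>lborel)"
    by (subst nn_integral_multc) (simp_all add: pre)
  also have "\<dots> = (\<integral>\<^sup>+x. indicator A (L x) * (\<integral>\<^sup>+y. indicator B (L x + y) \<partial>lborel) \<partial>lborel)"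
  proof -
    have "(\<integral>\<^sup>+y. indicator B y \<partial>lborel) = (\<integral>\<^sup>+y. indicator B (t + y) \<partial>lborel)" for t
      by (subst nn_integral_lborel_affine[of _ 1 t]) auto
    then show ?thesis by simp
  qed
  also have "\<dots> = (\<integral>\<^sup>+x. (\<integral>\<^sup>+y. indicator A (L x) * indicator B (L x + y) \<partial>lborel) \<partial>lborel)"
    by (simp add: nn_integral_cmult)
  also have "\<dots> = (\<integral>\<^sup>+y. (\<integral>\<^sup>+x. indicator A (L x) * indicator B (L x + y) \<partial>lborel) \<partial>lborel)"
    by (rule lborel_pair.Fubini') measurable
  \<comment> \<open>Translate x by \<open>- L y\<close>: as L is a linear involution,
    \<open>L x\<close> becomes \<open>L x - y\<close> and \<open>L x + y\<close> becomes
    \<open>L x\<close>.\<close>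
  also have "\<dots> = (\<integral>\<^sup>+y. (\<integral>\<^sup>+x. indicator A (L x - y) * indicator B (L x) \<partial>lborel) \<partial>lborel)"
  proof (rule nn_integral_cong)
    fix y
    show "(\<integral>\<^sup>+x. indicator A (L x) * indicator B (L x + y) \<partial>lborel)
        = (\<integral>\<^sup>+x. indicator A (L x - y) * indicator B (L x) \<partial>lborel)"
      by (subst nn_integral_lborel_affine[of _ 1 "- L y"])
         (simp_all add: linear_diff[OF L(1)] L(2) flip: diff_conv_add_uminus)
  qed
  also have "\<dots> = (\<integral>\<^sup>+x. (\<integral>\<^sup>+y. indicator A (L x - y) * indicator B (L x) \<partial>lborel) \<partial>lborel)"
    by (rule lborel_pair.Fubini') measurable
  also have "\<dots> = (\<integral>\<^sup>+x. (\<integral>\<^sup>+y. indicator A (L x - y) \<partial>lborel) * indicator B (L x) \<partial>lborel)"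
    by (simp add: nn_integral_multc)
  also have "\<dots> = (\<integral>\<^sup>+x. emeasure lborel A * indicator B (L x) \<partial>lborel)"
  proof -
    have "(\<integral>\<^sup>+y. indicator A (t - y) \<partial>lborel) = emeasure lborel A" for t
      using nn_integral_lborel_affine[of "indicator A" "- 1" t] by simp
    then show ?thesis by simp
  qed
  also have "\<dots> = emeasure lborel A * emeasure lborel (L -` B)"
    by (subst nn_integral_cmult) (simp_all add: pre)
  finally show ?thesis .
qed

text \<open>Preimages scale the measure by a constant factor. Comparing a ball with its own preimage
  under L, whose preimage is the ball again, shows that the square of the factor is 1; no
  determinant is involved.\<close>

lemma emeasure_linear_involution:
  fixes L :: "'a::euclidean_space \<Rightarrow> 'a"
  assumes L: "linear L" "\<And>x. L (L x) = x" and A: "A \<in> sets borel"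
  shows "emeasure lborel (L -` A) = emeasure lborel A"
proof -
  have [measurable]: "L \<in> borel_measurable borel" using L(1) by (rule borel_measurable_linear)
  let ?B = "ball 0 1 :: 'a set"
  let ?b = "emeasure lborel ?B" and ?c = "emeasure lborel (L -` ?B)"
  have LB: "L -` ?B \<in> sets borel" using measurable_sets_borel[of L borel ?B] by simp
  have b: "0 < ?b" "?b < \<infinity>"
    by (auto simp: emeasure_ball unit_ball_vol_pos emeasure_lborel_ball_finite)
  have "L -` (L -` ?B) = ?B" using L(2) by auto
  then have "?b * ?b = ?c * ?c"
    using emeasure_linear_involution_aux[OF L LB, of ?B] by simp
  then have "?b = ?c"
  proof -
    assume eq: "?b * ?b = ?c * ?c"
    have "?c \<noteq> \<infinity>" using eq b by (auto simp: ennreal_mult_eq_top_iff)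
    then have "?c < \<infinity>" by (simp add: top.not_eq_extremum)
    have "?c \<noteq> 0" using eq b by auto
    then have c: "0 < ?c" by (simp add: zero_less_iff_neq_zero)
    show ?thesis
    proof (rule linorder_cases[of ?b ?c])
      assume "?b < ?c"
      then have "?b * ?b < ?c * ?b" using b by (intro ennreal_mult_strict_right_mono) auto
      also have "\<dots> < ?c * ?c" using \<open>?b < ?c\<close> c \<open>?c < \<infinity>\<close> by (intro ennreal_mult_strict_left_mono) auto
      finally show ?thesis using eq by simp
    next
      assume "?c < ?b"
      then have "?c * ?c < ?b * ?c" using c \<open>?c < \<infinity>\<close> by (intro ennreal_mult_strict_right_mono) auto
      also have "\<dots> < ?b * ?b" using \<open>?c < ?b\<close> b by (intro ennreal_mult_strict_left_mono) auto
      finally show ?thesis using eq by simp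
    qed
  qed
  moreover have "emeasure lborel (L -` A) * ?b = emeasure lborel A * ?c"
    using emeasure_linear_involution_aux[OF L A, of ?B] by simp
  ultimately have "?b * emeasure lborel (L -` A) = ?b * emeasure lborel A" by (simp add: mult.commute)
  then show ?thesis using b by (auto simp: ennreal_mult_cancel_left)
qed

section \<open>Volume as the measure of a cone\<close>

text \<open>Change of variables between the vertical coordinate t and the scaling factor s above a
  fixed v of norm r. In the hyperbolic case t = sqrt (s^2 + r^2); in the spherical case s = sqrt
  (t^2 + r^2), with the roles exchanged.\<close>

lemma nn_integral_sqrt_substitution:
  assumes [measurable]: "F \<in> borel_measurable borel" and r: "0 < r"
  defines "g \<equiv> (\<lambda>x::real. sqrt (x\<^sup>2 + r\<^sup>2))"
  shows "(\<integral>\<^sup>+t. F t * indicator {r..g 1} t \<partial>lborel)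
       = (\<integral>\<^sup>+s. F (g s) * ennreal (s / g s) * indicator {0..1} s \<partial>lborel)"
proof -
  have pos: "0 < x\<^sup>2 + r\<^sup>2" for x using r by (simp add: add_nonneg_pos)
  have "(\<integral>\<^sup>+t. F t * indicator {g 0..g 1} t \<partial>lborel)
       = (\<integral>\<^sup>+s. F (g s) * ennreal (s / g s) * indicator {0..1} s \<partial>lborel)"
  proof (rule nn_integral_substitution_aux)
    show "(g has_real_derivative (x / g x)) (at x)" for x
      unfolding g_def using pos[of x] by (auto intro!: derivative_eq_intros simp: field_simps)
    show "continuous_on {0..1} (\<lambda>s. s / g s)"
      unfolding g_def using pos by (intro continuous_intros) (auto simp: less_imp_neq[symmetric])
    show "0 \<le> x / g x" if "x \<in> {0..1}" for x using that by (simp add: g_def)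
  qed auto
  moreover have "g 0 = r" using r by (simp add: g_def)
  ultimately show ?thesis by simp
qed

definition cone_over :: "(real \<times> 'v::euclidean_space) set \<Rightarrow> (real \<times> 'v) set" where
  "cone_over A = {s *\<^sub>R x | s x. 0 < s \<and> s < 1 \<and> x \<in> A}"

text \<open>The gauge that recovers the factor s from a point s x of a cone. Since
  \<open>sqrt\<close> is odd, a negative radicand gives a negative value, so
  \<open>0 < height X z\<close> also rules out points outside the light cone.\<close>

definition height :: "geometry \<Rightarrow> real \<times> 'v::euclidean_space \<Rightarrow> real" where
  "height X z = sqrt ((fst z)\<^sup>2 + curv X * (snd z \<bullet> snd z))"

lemma height_model: "x \<in> model X \<Longrightarrow> height X x = 1"
  by (simp add: model_iff height_def)

lemma height_scaleR: "0 \<le> s \<Longrightarrow> height X (s *\<^sub>R x) = s * height X x"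
proof -
  assume s: "0 \<le> s"
  have "(s * fst x)\<^sup>2 + curv X * (s *\<^sub>R snd x \<bullet> s *\<^sub>R snd x) = s\<^sup>2 * ((fst x)\<^sup>2 + curv X * (snd x \<bullet> snd x))"
    by (simp add: algebra_simps power2_eq_square)
  then show ?thesis using s by (simp add: height_def real_sqrt_mult)
qed

lemma cone_over_iff:
  assumes "A \<subseteq> model X"
  shows "z \<in> cone_over A \<longleftrightarrow> 0 < height X z \<and> height X z < 1 \<and> z /\<^sub>R height X z \<in> A"
proof
  assume "z \<in> cone_over A"
  then obtain s x where "0 < s" "s < 1" "x \<in> A" "z = s *\<^sub>R x" by (auto simp: cone_over_def)
  then show "0 < height X z \<and> height X z < 1 \<and> z /\<^sub>R height X z \<in> A"
    using assms by (auto simp: height_scaleR height_model subset_iff simp del: split_paired_All)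
next
  assume *: "0 < height X z \<and> height X z < 1 \<and> z /\<^sub>R height X z \<in> A"
  then have "z = height X z *\<^sub>R (z /\<^sub>R height X z)" by simp
  with * show "z \<in> cone_over A" unfolding cone_over_def by blast
qed

lemma borel_measurable_height [measurable]: "height X \<in> borel_measurable borel"
  unfolding height_def borel_prod[symmetric] by measurable

lemma sets_borel_cone_over:
  assumes A: "A \<in> sets borel" "A \<subseteq> model X"
  shows "cone_over A \<in> sets borel"
proof -
  note A(1)[measurable]
  have "cone_over A = {z \<in> space borel. 0 < height X z \<and> height X z < 1 \<and> z /\<^sub>R height X z \<in> A}"
    using cone_over_iff[OF A(2)] by auto
  also have "\<dots> \<in> sets borel" by measurable
  finally show ?thesis .
qed

text \<open>The integrand of \<open>gvolume\<close> for subsets of the upper sheet, where at most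
  one t lies above each w. In this closed form it is visibly measurable.\<close>

definition sheet_density ::
  "geometry \<Rightarrow> (real \<times> 'v::euclidean_space) set \<Rightarrow> 'v \<Rightarrow> ennreal" where
  "sheet_density X A w = indicator {w. curv X * (w \<bullet> w) < 1 \<and> (sqrt (1 - curv X * (w \<bullet> w)), w) \<in> A} w
     * ennreal (1 / sqrt (1 - curv X * (w \<bullet> w)))"

lemma borel_measurable_sheet_density [measurable]:
  assumes [measurable]: "A \<in> sets borel"
  shows "sheet_density X A \<in> borel_measurable borel"
proof -
  have 1: "(\<lambda>w. (sqrt (1 - curv X * (w \<bullet> w)), w)) \<in> borel \<rightarrow>\<^sub>M borel"
    by (intro borel_measurable_continuous_onI continuous_intros)
  have "{w \<in> space borel. curv X * (w \<bullet> w) < 1 \<and> (sqrt (1 - curv X * (w \<bullet> w)), w) \<in> A} \<in> sets borel"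
    using measurable_sets_borel[OF 1 assms]
    by (intro sets.sets_Collect_conj) (simp_all add: vimage_def)
  then show ?thesis unfolding sheet_density_def by (intro borel_measurable_times_ennreal borel_measurable_indicator) auto
qed

lemma gvolume_sheet:
  assumes A: "A \<subseteq> model X" "A \<subseteq> {x. 0 < fst x}"
  shows "(\<Sum>t \<in> {t. (t, w) \<in> A}. ennreal (1 / \<bar>t\<bar>)) = sheet_density X A w"
proof (cases "curv X * (w \<bullet> w) < 1 \<and> (sqrt (1 - curv X * (w \<bullet> w)), w) \<in> A")
  case True
  have "t = sqrt (1 - curv X * (w \<bullet> w))" if "(t, w) \<in> A" for t
  proof -
    have "t\<^sup>2 = 1 - curv X * (w \<bullet> w)" "0 < t"
      using that A model_iff[of "(t, w)" X] by force+
    then show ?thesis by (metis less_eq_real_def real_sqrt_unique)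
  qed
  then have "{t. (t, w) \<in> A} = {sqrt (1 - curv X * (w \<bullet> w))}" using True by auto
  then show ?thesis using True by (simp add: sheet_density_def)
next
  case False
  have "(t, w) \<notin> A" for t
  proof
    assume t: "(t, w) \<in> A"
    then have t': "t\<^sup>2 = 1 - curv X * (w \<bullet> w)" "0 < t"
      using A model_iff[of "(t, w)" X] by force+
    then have "sqrt (1 - curv X * (w \<bullet> w)) = t" by (metis less_eq_real_def real_sqrt_unique)
    moreover have "0 < t\<^sup>2" using t'(2) by simp
    then have "curv X * (w \<bullet> w) < 1" using t'(1) by linarith
    ultimately show False using False t by auto
  qed
  then have "{t. (t, w) \<in> A} = {}" by blast
  then show ?thesis using False by (auto simp: sheet_density_def)
qed

text \<open>A cone point (t, v) with scaling factor s lies over (t / s, v / s) in the model. On the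
  hyperboloid dt = (s / t) ds, on the sphere ds = (t / s) dt: in both cases s / t is exactly the
  volume density at that model point. The assumption on v makes r positive, so the substitution is
  smooth.\<close>

lemma cone_over_section_integral:
  fixes A :: "(real \<times> 'v::euclidean_space) set"
  assumes A: "A \<in> sets borel" "A \<subseteq> model X" "A \<subseteq> {x. 0 < fst x}" and X: "X \<noteq> Euclidean"
    and v: "v \<noteq> 0"
  shows "(\<integral>\<^sup>+t. indicator (cone_over A) (t, v) \<partial>lborel)
       = (\<integral>\<^sup>+s. indicator {0<..<1} s * sheet_density X A (v /\<^sub>R s) \<partial>lborel)"
proof -
  note A(1)[measurable]
  have [measurable]: "cone_over A \<in> sets borel" using sets_borel_cone_over A by blast
  define r where "r = norm v"
  have r: "0 < r" "v \<bullet> v = r\<^sup>2" using v by (auto simp: r_def power2_norm_eq_inner)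
  define g where "g x = sqrt (x\<^sup>2 + r\<^sup>2)" for x
  have g_pos: "0 < g x" for x using r(1) by (simp add: g_def add_nonneg_pos)
  have g_sq: "(g x)\<^sup>2 = x\<^sup>2 + r\<^sup>2" for x by (simp add: g_def)
  have vs: "(v /\<^sub>R s) \<bullet> (v /\<^sub>R s) = r\<^sup>2 / s\<^sup>2" for s
    by (simp add: r power2_eq_square divide_inverse)
  note subst = nn_integral_sqrt_substitution[OF _ r(1), folded g_def]
  have cone_pos: "0 < t" if t: "(t, v) \<in> cone_over A" for t
  proof -
    obtain s x where x: "0 < s" "x \<in> A" "(t, v) = s *\<^sub>R x" using t unfolding cone_over_def by blast
    then have "t = s * fst x" by (metis fst_conv fst_scaleR real_scaleR_def)
    then show ?thesis using x A(3) by auto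
  qed
  show ?thesis
  proof (cases X)
    case Hyperbolic
    have hgt: "height X (t, v) = sqrt (t\<^sup>2 - r\<^sup>2)" for t by (simp add: Hyperbolic height_def r)
    have "(\<integral>\<^sup>+t. indicator (cone_over A) (t, v) \<partial>lborel)
        = (\<integral>\<^sup>+t. indicator (cone_over A) (t, v) * indicator {r..g 1} t \<partial>lborel)"
    proof (rule nn_integral_cong)
      fix t
      have "t \<in> {r..g 1}" if "(t, v) \<in> cone_over A"
      proof -
        have "r\<^sup>2 < t\<^sup>2" "t\<^sup>2 < (g 1)\<^sup>2" "0 < t"
          using that cone_over_iff[OF A(2)] hgt cone_pos by (auto simp: g_sq)
        then have "r < t" "t < g 1"
          using g_pos[of 1] power_less_imp_less_base[of r 2 t] power_less_imp_less_base[of t 2 "g 1"] by simp_all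
        then show ?thesis by simp
      qed
      then show "indicator (cone_over A) (t, v) = indicator (cone_over A) (t, v) * (indicator {r..g 1} t :: ennreal)"
        by (auto simp: indicator_def)
    qed
    also have "\<dots> = (\<integral>\<^sup>+s. indicator (cone_over A) (g s, v) * ennreal (s / g s) * indicator {0..1} s \<partial>lborel)"
      by (rule subst) measurable
    also have "\<dots> = (\<integral>\<^sup>+s. indicator {0<..<1} s * sheet_density X A (v /\<^sub>R s) \<partial>lborel)"
    proof (rule nn_integral_cong)
      fix s :: real
      show "indicator (cone_over A) (g s, v) * ennreal (s / g s) * indicator {0..1} s
          = indicator {0<..<1} s * sheet_density X A (v /\<^sub>R s)"
      proof (cases "0 < s \<and> s < 1")
        case True
        have h: "height X (g s, v) = s" using True by (simp add: hgt g_sq)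
        have "1 + (r\<^sup>2 / s\<^sup>2) = (g s / s)\<^sup>2" using True by (simp add: power_divide g_sq field_simps)
        then have T: "sqrt (1 - curv X * ((v /\<^sub>R s) \<bullet> (v /\<^sub>R s))) = g s / s"
          using True g_pos[of s] unfolding vs by (simp add: Hyperbolic)
        have c: "curv X * ((v /\<^sub>R s) \<bullet> (v /\<^sub>R s)) < 1"
          using r True by (simp add: Hyperbolic vs less_le_trans[of _ 0] del: inner_scaleR_left inner_scaleR_right)
        have "(g s, v) \<in> cone_over A \<longleftrightarrow> (g s / s, v /\<^sub>R s) \<in> A"
          using cone_over_iff[OF A(2)] True by (simp add: h divide_inverse_commute)
        then show ?thesis using True c
          by (auto simp: indicator_def sheet_density_def T simp del: inner_scaleR_left inner_scaleR_right)
      next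
        case False
        then have "(g s, v) \<notin> cone_over A" if "0 \<le> s"
          using cone_over_iff[OF A(2)] that by (auto simp: hgt g_sq)
        then show ?thesis using False by (auto simp: indicator_def)
      qed
    qed
    finally show ?thesis .
  next
    case Spherical
    have hgt: "height X (t, v) = g t" for t by (simp add: Spherical height_def r g_def)
    have dens: "sheet_density X A (v /\<^sub>R g t) = indicator A (t / g t, v /\<^sub>R g t) * ennreal (g t / t)"
      if "0 < t" for t
    proof -
      have 1: "1 - (r\<^sup>2 / (g t)\<^sup>2) = (t / g t)\<^sup>2"
      proof -
        have "(g t)\<^sup>2 \<noteq> 0" using g_pos[of t] by simp
        then have "1 - r\<^sup>2 / (g t)\<^sup>2 = ((g t)\<^sup>2 - r\<^sup>2) / (g t)\<^sup>2"
          using g_pos[of t] by (simp add: diff_divide_distrib)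
        then show ?thesis by (simp add: power_divide g_sq)
      qed
      then have T: "sqrt (1 - curv X * ((v /\<^sub>R g t) \<bullet> (v /\<^sub>R g t))) = t / g t"
        using that g_pos[of t] unfolding vs by (simp add: Spherical)
      have "0 < (t / g t)\<^sup>2" using that g_pos[of t] by simp
      then have "curv X * ((v /\<^sub>R g t) \<bullet> (v /\<^sub>R g t)) < 1"
        unfolding vs Spherical curv.simps mult_1_left using 1 by linarith
      then show ?thesis
        by (auto simp: indicator_def sheet_density_def T simp del: inner_scaleR_left inner_scaleR_right)
    qed
    have "(\<integral>\<^sup>+s. indicator {0<..<1} s * sheet_density X A (v /\<^sub>R s) \<partial>lborel)
        = (\<integral>\<^sup>+s. indicator {0<..<1} s * sheet_density X A (v /\<^sub>R s) * indicator {r..g 1} s \<partial>lborel)"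
    proof (rule nn_integral_cong)
      fix s :: real
      have "s \<in> {r..g 1}" if s: "0 < s" "s < 1" "sheet_density X A (v /\<^sub>R s) \<noteq> 0"
      proof -
        have "(v /\<^sub>R s) \<bullet> (v /\<^sub>R s) < 1" using s(3) by (auto simp: sheet_density_def Spherical indicator_def split: if_splits)
        then have "r\<^sup>2 < s\<^sup>2" using s unfolding vs by simp
        then have "r < s" using s power_less_imp_less_base[of r 2 s] by simp
        moreover have "1 \<le> g 1" by (simp add: g_def)
        ultimately show ?thesis using s by simp
      qed
      then show "indicator {0<..<1} s * sheet_density X A (v /\<^sub>R s)
          = indicator {0<..<1} s * sheet_density X A (v /\<^sub>R s) * indicator {r..g 1} s"
        by (auto simp: indicator_def)
    qed
    also have "\<dots> = (\<integral>\<^sup>+t. indicator {0<..<1} (g t) * sheet_density X A (v /\<^sub>R g t) * ennreal (t / g t) * indicator {0..1} t \<partial>lborel)"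
      by (rule subst) measurable
    also have "\<dots> = (\<integral>\<^sup>+t. indicator (cone_over A) (t, v) \<partial>lborel)"
    proof (rule nn_integral_cong)
      fix t :: real
      show "indicator {0<..<1} (g t) * sheet_density X A (v /\<^sub>R g t) * ennreal (t / g t) * indicator {0..1} t
          = indicator (cone_over A) (t, v)"
      proof (cases "0 < t")
        case True
        have mem: "(t, v) \<in> cone_over A \<longleftrightarrow> g t < 1 \<and> (t / g t, v /\<^sub>R g t) \<in> A"
          using cone_over_iff[OF A(2)] g_pos[of t] by (simp add: hgt divide_inverse_commute)
        have "t < g t" unfolding g_def using r(1) by (intro real_less_rsqrt) simp
        moreover have "ennreal (g t / t) * ennreal (t / g t) = 1"
          using True g_pos[of t] by (simp flip: ennreal_mult)
        ultimately show ?thesis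
          using True g_pos[of t] unfolding dens[OF True] by (auto simp: indicator_def mem)
      next
        case False
        then show ?thesis using cone_pos[of t] by (auto simp: indicator_def)
      qed
    qed
    finally show ?thesis by simp
  qed (use X in simp)
qed

text \<open>The radial integral of s^d over the unit interval, equal to 1 / (d + 1). Being positive
  and finite, it can be cancelled.\<close>

definition cone_const :: "nat \<Rightarrow> ennreal" where
  "cone_const d = (\<integral>\<^sup>+s. indicator {0<..<1::real} s * ennreal (\<bar>s\<bar> ^ d) \<partial>lborel)"

lemma cone_const_pos_finite: "cone_const d \<noteq> 0" "cone_const d \<noteq> \<infinity>"
proof -
  have "ennreal ((1/2) ^ d) * (1/2) = (\<integral>\<^sup>+s. ennreal ((1/2) ^ d) * indicator {1/2<..<1::real} s \<partial>lborel)"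
    by (subst nn_integral_cmult_indicator) (auto simp: divide_ennreal_def)
  also have "\<dots> \<le> cone_const d"
    unfolding cone_const_def
    by (intro nn_integral_mono) (auto simp: indicator_def power_mono intro!: ennreal_leI)
  finally have "0 < cone_const d"
    by (rule less_le_trans[rotated]) (simp add: ennreal_zero_less_mult_iff ennreal_zero_less_divide)
  then show "cone_const d \<noteq> 0" by simp
  have "cone_const d \<le> (\<integral>\<^sup>+s. indicator {0<..<1::real} s \<partial>lborel)"
    unfolding cone_const_def
    by (intro nn_integral_mono) (auto simp: indicator_def power_le_one intro!: ennreal_le_1[THEN iffD2])
  also have "\<dots> = 1" by simp
  finally show "cone_const d \<noteq> \<infinity>" by (auto simp: top_unique)
qed

text \<open>After the change from t to s on each vertical line (outside the null set v = 0),
  exchanging the integrals and scaling v by s separates the radial factor s^d from the volume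
  integral.\<close>

lemma emeasure_cone_over_sheet:
  fixes A :: "(real \<times> 'v::euclidean_space) set"
  assumes A: "A \<in> sets borel" "A \<subseteq> model X" "A \<subseteq> {x. 0 < fst x}" and X: "X \<noteq> Euclidean"
  shows "emeasure lborel (cone_over A) = cone_const DIM('v) * gvolume A"
proof -
  note A(1)[measurable]
  have C[measurable]: "cone_over A \<in> sets borel" using sets_borel_cone_over A by blast
  have C'[measurable]: "cone_over A \<in> sets (borel \<Otimes>\<^sub>M borel)" using C by (simp only: borel_prod)
  have scale: "(\<integral>\<^sup>+v. sheet_density X A (v /\<^sub>R s) \<partial>lborel)
      = ennreal (\<bar>s\<bar> ^ DIM('v)) * (\<integral>\<^sup>+v. sheet_density X A v \<partial>lborel)" if "0 < s" for s
    using nn_integral_lborel_affine[of "\<lambda>v. sheet_density X A (v /\<^sub>R s)" s 0] that by simp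
  have "emeasure lborel (cone_over A) = (\<integral>\<^sup>+z. indicator (cone_over A) z \<partial>(lborel \<Otimes>\<^sub>M lborel))"
    by (simp add: lborel_prod)
  also have "\<dots> = (\<integral>\<^sup>+v. (\<integral>\<^sup>+t. indicator (cone_over A) (t, v) \<partial>lborel) \<partial>lborel)"
    by (rule lborel_pair.nn_integral_snd[symmetric]) (use C in \<open>simp add: lborel_prod\<close>)
  also have "\<dots> = (\<integral>\<^sup>+v. (\<integral>\<^sup>+s. indicator {0<..<1} s * sheet_density X A (v /\<^sub>R s) \<partial>lborel) \<partial>lborel)"
    by (rule nn_integral_cong_AE) (use AE_lborel_singleton[of 0] cone_over_section_integral[OF A X] in \<open>auto elim: eventually_mono\<close>)
  also have "\<dots> = (\<integral>\<^sup>+s. (\<integral>\<^sup>+v. indicator {0<..<1} s * sheet_density X A (v /\<^sub>R s) \<partial>lborel) \<partial>lborel)"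
    by (rule lborel_pair.Fubini') measurable
  also have "\<dots> = (\<integral>\<^sup>+s. indicator {0<..<1} s * ennreal (\<bar>s\<bar> ^ DIM('v)) * (\<integral>\<^sup>+v. sheet_density X A v \<partial>lborel) \<partial>lborel)"
  proof (rule nn_integral_cong)
    fix s :: real
    have "(\<integral>\<^sup>+v. indicator {0<..<1} s * sheet_density X A (v /\<^sub>R s) \<partial>lborel)
        = indicator {0<..<1} s * (\<integral>\<^sup>+v. sheet_density X A (v /\<^sub>R s) \<partial>lborel)"
      by (rule nn_integral_cmult) measurable
    then show "(\<integral>\<^sup>+v. indicator {0<..<1} s * sheet_density X A (v /\<^sub>R s) \<partial>lborel)
        = indicator {0<..<1} s * ennreal (\<bar>s\<bar> ^ DIM('v)) * (\<integral>\<^sup>+v. sheet_density X A v \<partial>lborel)"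
      using scale[of s] by (auto simp: indicator_def)
  qed
  also have "\<dots> = cone_const DIM('v) * (\<integral>\<^sup>+v. sheet_density X A v \<partial>lborel)"
    unfolding cone_const_def by (rule nn_integral_multc) measurable
  also have "(\<integral>\<^sup>+v. sheet_density X A v \<partial>lborel) = gvolume A"
    unfolding gvolume_def gvolume_sheet[OF A(2,3)] ..
  finally show ?thesis .
qed

definition flip :: "real \<times> 'v::euclidean_space \<Rightarrow> real \<times> 'v" where
  "flip z = (- fst z, snd z)"

lemma flip_simps [simp]: "flip (flip z) = z" "fst (flip z) = - fst z" "snd (flip z) = snd z"
  by (simp_all add: flip_def)

lemma linear_flip: "linear flip"
  by (rule linearI) (simp_all add: flip_def prod_eq_iff)

lemma flip_in_model: "flip z \<in> model Spherical \<longleftrightarrow> z \<in> model Spherical"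
  by (simp add: model_iff del: model.simps)

lemma flip_cone_over: "flip z \<in> cone_over A \<longleftrightarrow> z \<in> cone_over (flip -` A)"
proof -
  have "\<exists>s x. 0 < s \<and> s < 1 \<and> x \<in> flip -` A \<and> z = s *\<^sub>R x" if "flip z = s *\<^sub>R x" "0 < s" "s < 1" "x \<in> A" for s x
  proof -
    have "z = s *\<^sub>R flip x" using arg_cong[OF that(1), of flip] linear_scale[OF linear_flip] by simp
    moreover have "flip x \<in> flip -` A" using that by simp
    ultimately show ?thesis using that by blast
  qed
  moreover have "\<exists>s x. 0 < s \<and> s < 1 \<and> x \<in> A \<and> flip z = s *\<^sub>R x" if "z = s *\<^sub>R x" "0 < s" "s < 1" "x \<in> flip -` A" for s x
    using that linear_scale[OF linear_flip, of s x] by blast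
  ultimately show ?thesis unfolding cone_over_def by blast
qed

lemma emeasure_lborel_fst_0: "emeasure lborel {z :: real \<times> 'v::euclidean_space. fst z = 0} = 0"
proof -
  have "negligible {z :: real \<times> 'v. (1, 0) \<bullet> z = 0}"
    by (rule negligible_hyperplane) (simp add: zero_prod_def)
  moreover have "{z :: real \<times> 'v. (1, 0) \<bullet> z = 0} = {z. fst z = 0}"
    by (auto simp: inner_prod_def)
  ultimately have "{z :: real \<times> 'v. fst z = 0} \<in> null_sets lebesgue"
    by (simp add: negligible_iff_null_sets)
  moreover have "{z :: real \<times> 'v. fst z = 0} \<in> sets borel"
    by (intro borel_closed closed_Collect_eq continuous_intros)
  ultimately show ?thesis using null_sets_completion_iff[of "{z :: real \<times> 'v. fst z = 0}" lborel] by (auto dest: null_setsD1)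
qed

lemma finite_model_slice:
  assumes "A \<subseteq> model X"
  shows "finite {t. (t, w) \<in> A}"
proof (rule finite_subset)
  let ?h = "sqrt (1 - curv X * (w \<bullet> w))"
  show "{t. (t, w) \<in> A} \<subseteq> {?h, - ?h}"
  proof
    fix t assume "t \<in> {t. (t, w) \<in> A}"
    then have "t\<^sup>2 = 1 - curv X * (w \<bullet> w)" using assms model_iff[of "(t, w)" X] by force
    then have "\<bar>t\<bar> = ?h" by (metis real_sqrt_abs)
    then show "t \<in> {?h, - ?h}" by (auto simp: abs_if split: if_splits)
  qed
qed simp

text \<open>On the sphere the lower hemisphere is flipped onto the upper one; \<open>flip\<close> is
  itself a linear involution, so the cone measure is unchanged. The cone over the equator lies in a
  null hyperplane.\<close>

lemma emeasure_cone_over: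
  fixes A :: "(real \<times> 'v::euclidean_space) set"
  assumes A: "A \<in> sets borel" "A \<subseteq> model X" and X: "X \<noteq> Euclidean"
  shows "emeasure lborel (cone_over A) = cone_const DIM('v) * gvolume A"
proof (cases "X = Hyperbolic")
  case True
  then show ?thesis using emeasure_cone_over_sheet[OF A _ X] A(2) model_gt0 X by force
next
  case False
  with X have X: "X = Spherical" by (cases X) auto
  have [measurable]: "flip \<in> borel_measurable borel" using linear_flip by (rule borel_measurable_linear)
  note A(1)[measurable]
  define P where "P = {x :: real \<times> 'v. 0 < fst x}"
  define Z where "Z = {x :: real \<times> 'v. fst x = 0}"
  have P[measurable]: "P \<in> sets borel" unfolding P_def by (intro borel_open open_Collect_less continuous_intros)
  have Z: "Z \<in> sets borel" unfolding Z_def by (intro borel_closed closed_Collect_eq continuous_intros)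
  have fA: "flip -` A \<in> sets borel" using measurable_sets_borel[of flip borel A] by simp
  define U where "U = A \<inter> P"
  define D where "D = flip -` A \<inter> P"
  have U: "U \<in> sets borel" "U \<subseteq> model X" "U \<subseteq> {x. 0 < fst x}"
    using A P by (auto simp: U_def) (simp add: P_def)
  have D: "D \<in> sets borel" "D \<subseteq> model X" "D \<subseteq> {x. 0 < fst x}"
  proof -
    show "D \<in> sets borel" using fA P by (simp add: D_def)
    show "D \<subseteq> model X" unfolding X D_def using A(2) flip_in_model unfolding X by blast
    show "D \<subseteq> {x. 0 < fst x}" by (simp add: D_def P_def)
  qed
  have cone_sign: "z \<in> cone_over U \<longleftrightarrow> z \<in> cone_over A \<and> 0 < fst z"
    "flip z \<in> cone_over D \<longleftrightarrow> z \<in> cone_over A \<and> fst z < 0" for z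
  proof -
    have sgn: "x \<in> P \<longleftrightarrow> s *\<^sub>R x \<in> P" if "0 < s" for s and x :: "real \<times> 'v"
      using that by (simp add: P_def zero_less_mult_iff)
    have *: "z \<in> cone_over (B \<inter> P) \<longleftrightarrow> z \<in> cone_over B \<and> 0 < fst z" for B and z :: "real \<times> 'v"
    proof -
      have "z \<in> cone_over (B \<inter> P) \<longleftrightarrow> z \<in> cone_over B \<and> z \<in> P"
        unfolding cone_over_def mem_Collect_eq Int_iff using sgn by metis
      then show ?thesis by (simp add: P_def)
    qed
    show "z \<in> cone_over U \<longleftrightarrow> z \<in> cone_over A \<and> 0 < fst z" unfolding U_def by (rule *)
    show "flip z \<in> cone_over D \<longleftrightarrow> z \<in> cone_over A \<and> fst z < 0"
      unfolding D_def * flip_cone_over[of "flip z" A, symmetric] by simp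
  qed
  have CA: "cone_over A \<in> sets lborel" and CU: "cone_over U \<in> sets lborel" and CD: "cone_over D \<in> sets lborel"
    using sets_borel_cone_over[OF A] sets_borel_cone_over[OF U(1,2)] sets_borel_cone_over[OF D(1,2)] by simp_all
  have fCD: "flip -` cone_over D \<in> sets lborel"
    using measurable_sets_borel[of flip borel "cone_over D"] CD by simp
  have "cone_over A - Z = cone_over U \<union> flip -` cone_over D"
  proof (rule set_eqI)
    fix z
    show "z \<in> cone_over A - Z \<longleftrightarrow> z \<in> cone_over U \<union> flip -` cone_over D"
      unfolding Z_def Diff_iff Un_iff vimage_eq cone_sign mem_Collect_eq by (metis linorder_neq_iff)
  qed
  moreover have "emeasure lborel (cone_over A - Z) = emeasure lborel (cone_over A)"
    using CA Z emeasure_lborel_fst_0 by (intro emeasure_Diff_null_set) (auto simp: Z_def)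
  moreover have "emeasure lborel (cone_over U \<union> flip -` cone_over D)
      = emeasure lborel (cone_over U) + emeasure lborel (flip -` cone_over D)"
  proof (rule plus_emeasure[symmetric, OF CU fCD])
    show "cone_over U \<inter> flip -` cone_over D = {}"
      unfolding disjoint_iff vimage_eq cone_sign by (metis less_asym)
  qed
  moreover have "emeasure lborel (flip -` cone_over D) = emeasure lborel (cone_over D)"
    using CD by (intro emeasure_linear_involution linear_flip) auto
  ultimately have "emeasure lborel (cone_over A) = cone_const DIM('v) * (gvolume U + gvolume D)"
    using emeasure_cone_over_sheet[OF U] emeasure_cone_over_sheet[OF D] X by (simp add: distrib_left)
  also have "gvolume U + gvolume D = gvolume A"
  proof -
    let ?S = "\<lambda>B w. \<Sum>t \<in> {t. (t, w) \<in> B}. ennreal (1 / \<bar>t\<bar>)"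
    have "?S A w = ?S U w + ?S D w" for w
    proof -
      note fin = finite_model_slice[OF A(2), of w]
      let ?f = "\<lambda>t. ennreal (1 / \<bar>t\<bar>)"
      have "{t. (t, w) \<in> U} = {t \<in> {t. (t, w) \<in> A}. 0 < t}" by (simp add: U_def P_def)
      then have SU: "?S U w = (\<Sum>t | (t, w) \<in> A. if 0 < t then ?f t else 0)"
        using sum.inter_filter[OF fin, of ?f "\<lambda>t. 0 < t"] by simp
      have "{t. (t, w) \<in> D} = {t. (- t, w) \<in> A \<and> 0 < t}" by (simp add: D_def P_def flip_def)
      then have "?S D w = (\<Sum>t \<in> {t \<in> {t. (t, w) \<in> A}. t < 0}. ?f t)"
        by (intro sum.reindex_bij_witness[of _ uminus uminus]) simp_all
      then have SD: "?S D w = (\<Sum>t | (t, w) \<in> A. if t < 0 then ?f t else 0)"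
        using sum.inter_filter[OF fin, of ?f "\<lambda>t. t < 0"] by simp
      \<comment> \<open>The equator contributes nothing on either side, because 1 / 0 is 0.\<close>
      have "?S A w = (\<Sum>t | (t, w) \<in> A. (if 0 < t then ?f t else 0) + (if t < 0 then ?f t else 0))"
        by (rule sum.cong) auto
      also have "\<dots> = ?S U w + ?S D w" unfolding SU SD by (rule sum.distrib)
      finally show ?thesis .
    qed
    then show ?thesis
      using U(1) D(1) unfolding gvolume_def gvolume_sheet[OF U(2,3)] gvolume_sheet[OF D(2,3)]
      by (simp add: nn_integral_add borel_measurable_sheet_density)
  qed
  finally show ?thesis .
qed

section \<open>Balls as Borel sets and their volumes\<close>

lemma continuous_on_gdist:
  assumes "c \<in> model X"
  shows "continuous_on (model X) (\<lambda>x. gdist X x c)"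
proof (cases X)
  case Spherical
  have b: "(\<lambda>x. bil X x c) ` model X \<subseteq> {-1..1}"
    using bil_Spherical_bound[of _ c] assms by (force simp: Spherical abs_le_iff)
  have "continuous_on (model X) (\<lambda>x. bil X x c)"
    unfolding bil_def by (intro continuous_intros)
  from continuous_on_compose2[OF continuous_on_arccos' this b] show ?thesis
    by (simp only: Spherical gdist_Spherical)
next
  case Euclidean
  then show ?thesis by (auto intro!: continuous_intros)
next
  case Hyperbolic
  have b: "1 \<le> - bil X x c" if "x \<in> model X" for x
    using hyperbolic_bil_le(1)[of x c] assms that by (simp add: Hyperbolic)
  have "continuous_on (model X) (\<lambda>x. - bil X x c)"
    unfolding bil_def by (intro continuous_intros)
  moreover have "(\<lambda>x. - bil X x c) ` model X \<subseteq> {1..}"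
    by (rule image_subsetI) (metis b atLeast_iff)
  ultimately have "continuous_on (model X) (\<lambda>x. arcosh (- bil X x c))"
    by (rule continuous_on_compose2[OF continuous_on_arcosh[OF order_refl]])
  then show ?thesis by (simp only: Hyperbolic gdist_Hyperbolic)
qed

lemma sets_borel_model: "model X \<in> sets borel"
proof (cases X)
  case Spherical
  then show ?thesis
    unfolding Spherical model.simps by (intro borel_closed closed_Collect_eq continuous_intros)
next
  case Euclidean
  then show ?thesis
    unfolding Euclidean model.simps by (intro borel_closed closed_Collect_eq continuous_intros)
next
  case Hyperbolic
  show ?thesis
    unfolding Hyperbolic model.simps Collect_conj_eq
    by (rule sets.Int, rule borel_open, intro open_Collect_less continuous_intros,
        rule borel_closed, intro closed_Collect_eq continuous_intros)
qed

lemma gball_subset_model: "gball X c \<rho> \<subseteq> model X"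
  by (auto simp: gball_def)

lemma openin_gball:
  assumes "c \<in> model X"
  shows "openin (top_of_set (model X)) (gball X c \<rho>)"
proof -
  have "gball X c \<rho> = model X \<inter> (\<lambda>x. gdist X x c) -` {..<\<rho>}" by (auto simp: gball_def)
  then show ?thesis
    using continuous_openin_preimage_gen[OF continuous_on_gdist[OF assms], of "{..<\<rho>}"] by simp
qed

lemma sets_borel_gball:
  assumes "c \<in> model X"
  shows "gball X c \<rho> \<in> sets borel"
proof -
  obtain T where "open T" "gball X c \<rho> = model X \<inter> T"
    using openin_gball[OF assms] by (auto simp: openin_open)
  then show ?thesis using sets.Int[OF sets_borel_model borel_open] by simp
qed

text \<open>Outside the Euclidean case the reflection exchanging \<open>o\<close> and a is linear,
  because \<open>quad X\<close> agrees at both points and the constant term of \<open>side\<close>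
  vanishes. It carries the cone over one ball to the cone over the other. In the Euclidean case the
  volume is that of a ball in the chart.\<close>

lemma gvolume_gball:
  fixes a :: "real \<times> 'v::euclidean_space"
  assumes a: "a \<in> model X"
  shows "gvolume (gball X a \<rho>) = gvolume (gball X (origin :: real \<times> 'v) \<rho>)"
proof (cases "X = Euclidean \<or> a = origin")
  case True
  have eq: "gvolume (gball Euclidean c \<rho>) = emeasure lborel (ball (snd c) \<rho>)"
    if "c \<in> model Euclidean" for c :: "real \<times> 'v"
  proof -
    have "{t. (t, v) \<in> gball Euclidean c \<rho>} = (if v \<in> ball (snd c) \<rho> then {1} else {})" for v
      using that by (auto simp: gball_def dist_prod_def dist_commute)
    then have "(\<Sum>t \<in> {t. (t, v) \<in> gball Euclidean c \<rho>}. ennreal (1 / \<bar>t\<bar>)) = indicator (ball (snd c) \<rho>) v" for v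
      by (simp add: indicator_def)
    then show ?thesis unfolding gvolume_def by simp
  qed
  have ball: "emeasure lborel (ball c \<rho>) = emeasure lborel (ball (0::'v) \<rho>)" for c :: 'v
  proof (cases "0 \<le> \<rho>")
    case False
    then show ?thesis by (simp add: ball_empty)
  qed (simp add: emeasure_ball)
  then show ?thesis using True a by (cases "a = origin") (simp_all add: eq ball[of "snd a"] ball[of "snd origin"] del: model.simps)
next
  case False
  then interpret mirror X origin a using a by unfold_locales auto
  let ?L = "reflect X origin a"
  have X: "X \<noteq> Euclidean" using False by simp
  have "quad X (origin :: real \<times> 'v) = quad X a"
    using quad_model X a origin_in_model by metis
  then have "linear ?L"
    by (intro linearI) (simp_all add: reflect_def side_eq algebra_simps add_divide_distrib diff_divide_distrib)
  have maps: "?L x \<in> gball X a \<rho> \<longleftrightarrow> x \<in> gball X origin \<rho>" for x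
  proof -
    have "x \<in> model X \<longleftrightarrow> ?L x \<in> model X" using reflect_in_model reflect_reflect by metis
    then show ?thesis using gdist_reflect_reflect[of x origin] by (auto simp: gball_def reflect_p)
  qed
  have "?L -` cone_over (gball X a \<rho>) = cone_over (gball X origin \<rho>)"
  proof -
    have "?L z \<in> cone_over (gball X a \<rho>)" if "z \<in> cone_over (gball X origin \<rho>)" for z
      using that maps linear_scale[OF \<open>linear ?L\<close>] unfolding cone_over_def by blast
    moreover have "?L z \<in> cone_over (gball X origin \<rho>)" if "z \<in> cone_over (gball X a \<rho>)" for z
      using that maps[of "?L _"] linear_scale[OF \<open>linear ?L\<close>] unfolding cone_over_def reflect_reflect by blast
    ultimately show ?thesis by (metis (no_types, lifting) reflect_reflect subsetI subset_antisym vimageE vimageI2)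
  qed
  then have "emeasure lborel (cone_over (gball X (origin :: real \<times> 'v) \<rho>)) = emeasure lborel (cone_over (gball X a \<rho>))"
    using emeasure_linear_involution[OF \<open>linear ?L\<close>, of "cone_over (gball X a \<rho>)"]
      sets_borel_cone_over[OF sets_borel_gball[OF a] gball_subset_model] by simp
  moreover have vol: "emeasure lborel (cone_over (gball X c \<rho>)) = cone_const DIM('v) * gvolume (gball X c \<rho>)"
    if "c \<in> model X" for c :: "real \<times> 'v"
    by (rule emeasure_cone_over[OF sets_borel_gball[OF that] gball_subset_model X])
  ultimately have "cone_const DIM('v) * gvolume (gball X (origin :: real \<times> 'v) \<rho>) = cone_const DIM('v) * gvolume (gball X a \<rho>)"
    using vol[OF a] vol[OF origin_in_model] by simp
  then show ?thesis using cone_const_pos_finite[of "DIM('v)"] by (auto simp: ennreal_mult_cancel_left)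
qed

subsection \<open>The symmetric decreasing rearrangement of a tent function\<close>

fun chart_radius :: "geometry \<Rightarrow> real \<Rightarrow> real" where
  "chart_radius Spherical r = sin r"
| "chart_radius Euclidean r = r"
| "chart_radius Hyperbolic r = sinh r"

text \<open>Since 3/2 < \<pi>/2, such a ball stays in the open upper hemisphere and is the graph
  over a Euclidean ball. The bound exceeds 1 to leave room for balls larger than the superlevel sets
  of a tent.\<close>

lemma gball_origin_chart:
  fixes v :: "'v::euclidean_space"
  assumes r: "0 \<le> r" "r \<le> 3/2"
  shows "(t, v) \<in> gball X origin r \<longleftrightarrow>
    norm v < chart_radius X r \<and> curv X * (v \<bullet> v) < 1 \<and> t = sqrt (1 - curv X * (v \<bullet> v))"
proof (cases X)
  case Spherical
  have pi: "r < pi / 2" using r pi_gt3 by simp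
  have cos: "0 < cos r" using cos_gt_zero_pi[of r] r pi by simp
  have sin: "0 \<le> sin r" using sin_ge_zero[of r] r pi by simp
  have sq: "(sin r)\<^sup>2 = 1 - (cos r)\<^sup>2" by (rule sin_squared_eq)
  have "(t, v) \<in> gball X origin r \<longleftrightarrow> t\<^sup>2 + v \<bullet> v = 1 \<and> arccos t < r"
    using model_iff[of "(t, v)" X] by (simp add: gball_def Spherical origin_def)
  also have "\<dots> \<longleftrightarrow> t\<^sup>2 + v \<bullet> v = 1 \<and> cos r < t"
  proof -
    have "arccos t < r \<longleftrightarrow> cos r < t" if "t\<^sup>2 + v \<bullet> v = 1"
    proof -
      have "t\<^sup>2 \<le> 1" using that inner_ge_zero[of v] by linarith
      then have "\<bar>t\<bar> \<le> 1" by (simp add: abs_square_le_1)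
      then have "arccos t < arccos (cos r) \<longleftrightarrow> cos r < t" by (intro arccos_less_mono) auto
      then show ?thesis using r pi by (simp add: arccos_cos)
    qed
    then show ?thesis by blast
  qed
  also have "\<dots> \<longleftrightarrow> (norm v)\<^sup>2 < (sin r)\<^sup>2 \<and> v \<bullet> v < 1 \<and> t = sqrt (1 - v \<bullet> v)"
  proof
    assume *: "t\<^sup>2 + v \<bullet> v = 1 \<and> cos r < t"
    then have "(cos r)\<^sup>2 < t\<^sup>2" using cos by (intro power_strict_mono) auto
    moreover from this have "0 < t\<^sup>2" using zero_le_power2[of "cos r"] by linarith
    moreover have "1 - v \<bullet> v = t\<^sup>2" using * by simp
    moreover have "t = sqrt (t\<^sup>2)" using * cos by simp
    ultimately show "(norm v)\<^sup>2 < (sin r)\<^sup>2 \<and> v \<bullet> v < 1 \<and> t = sqrt (1 - v \<bullet> v)"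
      unfolding sq power2_norm_eq_inner by (intro conjI, linarith, linarith, metis)
  next
    assume *: "(norm v)\<^sup>2 < (sin r)\<^sup>2 \<and> v \<bullet> v < 1 \<and> t = sqrt (1 - v \<bullet> v)"
    then have "(cos r)\<^sup>2 < t\<^sup>2" "0 \<le> t" unfolding sq power2_norm_eq_inner by auto
    then have "cos r < t" by (rule power_less_imp_less_base)
    then show "t\<^sup>2 + v \<bullet> v = 1 \<and> cos r < t" using * by simp
  qed
  also have "(norm v)\<^sup>2 < (sin r)\<^sup>2 \<longleftrightarrow> norm v < sin r"
    using sin by (simp flip: not_le)
  finally show ?thesis by (simp add: Spherical)
next
  case Euclidean
  then show ?thesis by (auto simp: gball_def origin_def dist_Pair_Pair)
next
  case Hyperbolic
  have sq: "(sinh r)\<^sup>2 = (cosh r)\<^sup>2 - 1" by (rule sinh_square_eq)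
  have "(t, v) \<in> gball X origin r \<longleftrightarrow> (t\<^sup>2 - v \<bullet> v = 1 \<and> 0 < t) \<and> arcosh t < r"
    using model_iff[of "(t, v)" X] by (auto simp: gball_def Hyperbolic origin_def)
  also have "\<dots> \<longleftrightarrow> (t\<^sup>2 - v \<bullet> v = 1 \<and> 0 < t) \<and> t < cosh r"
  proof -
    have "arcosh t < r \<longleftrightarrow> t < cosh r" if "t\<^sup>2 - v \<bullet> v = 1 \<and> 0 < t"
    proof -
      have "1\<^sup>2 \<le> t\<^sup>2" using that inner_ge_zero[of v] unfolding one_power2 by linarith
      then have "1 \<le> t" using that by (metis less_eq_real_def power2_le_imp_le)
      then have "arcosh t < arcosh (cosh r) \<longleftrightarrow> t < cosh r"
        using cosh_real_ge_1 by (intro arcosh_less_iff_real)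
      then show ?thesis using r by (simp add: arcosh_cosh_real)
    qed
    then show ?thesis by blast
  qed
  also have "\<dots> \<longleftrightarrow> (norm v)\<^sup>2 < (sinh r)\<^sup>2 \<and> t = sqrt (1 + v \<bullet> v)"
  proof
    assume *: "(t\<^sup>2 - v \<bullet> v = 1 \<and> 0 < t) \<and> t < cosh r"
    then have "t\<^sup>2 < (cosh r)\<^sup>2" by (intro power_strict_mono) auto
    moreover have "1 + v \<bullet> v = t\<^sup>2" using * by simp
    moreover have "t = sqrt (t\<^sup>2)" using * by simp
    ultimately show "(norm v)\<^sup>2 < (sinh r)\<^sup>2 \<and> t = sqrt (1 + v \<bullet> v)"
      unfolding sq power2_norm_eq_inner by auto
  next
    assume *: "(norm v)\<^sup>2 < (sinh r)\<^sup>2 \<and> t = sqrt (1 + v \<bullet> v)"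
    have "t\<^sup>2 = 1 + v \<bullet> v" "0 < t" using * by (auto intro: add_pos_nonneg)
    moreover from this have "t\<^sup>2 < (cosh r)\<^sup>2" using * unfolding sq power2_norm_eq_inner by auto
    then have "t < cosh r" by (rule power_less_imp_less_base) simp
    ultimately show "(t\<^sup>2 - v \<bullet> v = 1 \<and> 0 < t) \<and> t < cosh r" by simp
  qed
  also have "(norm v)\<^sup>2 < (sinh r)\<^sup>2 \<longleftrightarrow> norm v < sinh r"
    using r by (simp flip: not_le)
  moreover have "- 1 < v \<bullet> v" using inner_ge_zero[of v] by linarith
  ultimately show ?thesis by (simp add: Hyperbolic)
qed

lemma chart_radius_strict_mono:
  assumes "0 \<le> r" "r < s" "s \<le> 3/2"
  shows "chart_radius X r < chart_radius X s"
  using assms pi_gt3 by (cases X) (auto intro!: sin_monotone_2pi)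

lemma gvolume_mono: "A \<subseteq> B \<Longrightarrow> B \<subseteq> model X \<Longrightarrow> gvolume A \<le> gvolume B"
  unfolding gvolume_def by (intro nn_integral_mono sum_mono2 finite_model_slice) auto

text \<open>Determines the radius of a rearranged ball by its volume. The smaller volume is finite,
  as the density is at most 1 / cos (3/2) there, and over the open annulus between the two chart
  radii only the larger ball has positive density.\<close>

lemma gvolume_gball_strict_mono:
  assumes r: "0 \<le> r" "r < s" "s \<le> 3/2"
  shows "gvolume (gball X (origin :: real \<times> 'v::euclidean_space) r) < gvolume (gball X (origin :: real \<times> 'v) s)"
proof -
  let ?B = "\<lambda>r. gball X (origin :: real \<times> 'v) r"
  have r32: "r \<le> 3/2" "0 \<le> s" using r by auto
  have pos: "?B q \<subseteq> {x. 0 < fst x}" if "0 \<le> q" "q \<le> 3/2" for q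
  proof
    fix x assume "x \<in> ?B q"
    then show "x \<in> {x. 0 < fst x}" using gball_origin_chart[OF that, of "fst x" "snd x" X] by simp
  qed
  have vol: "gvolume (?B q) = (\<integral>\<^sup>+w. sheet_density X (?B q) w \<partial>lborel)" if "0 \<le> q" "q \<le> 3/2" for q
    unfolding gvolume_def gvolume_sheet[OF gball_subset_model pos[OF that]] ..
  have dens: "sheet_density X (?B q) w = indicator (ball 0 (chart_radius X q) \<inter> {w. curv X * (w \<bullet> w) < 1}) w
     * ennreal (1 / sqrt (1 - curv X * (w \<bullet> w)))" if "0 \<le> q" "q \<le> 3/2" for q w
    unfolding sheet_density_def gball_origin_chart[OF that] by (auto simp: indicator_def)
  have meas: "sheet_density X (?B q) \<in> borel_measurable lborel" for q
    using borel_measurable_sheet_density[OF sets_borel_gball[OF origin_in_model]] by simp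
  have c: "0 < cos (3/2 :: real)" using pi_gt3 by (intro cos_gt_zero) simp_all
  have "(\<integral>\<^sup>+w. sheet_density X (?B r) w \<partial>lborel) < (\<integral>\<^sup>+w. sheet_density X (?B s) w \<partial>lborel)"
  proof (rule nn_integral_less[OF meas meas])
    have "(\<integral>\<^sup>+w. sheet_density X (?B r) w \<partial>lborel)
        \<le> (\<integral>\<^sup>+w. ennreal (1 / cos (3/2)) * indicator (ball (0 :: 'v) (chart_radius X r)) w \<partial>lborel)"
    proof (rule nn_integral_mono)
      fix w :: 'v
      have "cos (3/2) \<le> sqrt (1 - curv X * (w \<bullet> w))" if w: "norm w < chart_radius X r" "curv X * (w \<bullet> w) < 1"
      proof (cases "X = Spherical")
        case True
        have "(norm w)\<^sup>2 < (sin r)\<^sup>2" using w True by (intro power_strict_mono) auto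
        then have "(cos r)\<^sup>2 \<le> 1 - curv X * (w \<bullet> w)"
          using sin_squared_eq[of r] True by (simp add: power2_norm_eq_inner)
        then have "cos r \<le> sqrt (1 - curv X * (w \<bullet> w))" by (rule real_le_rsqrt)
        moreover have "cos (3/2) \<le> cos r" using r32 r pi_gt3 by (intro cos_monotone_0_pi_le) auto
        ultimately show ?thesis by linarith
      next
        case False
        then have "curv X * (w \<bullet> w) \<le> 0" by (cases X) auto
        then have "1 \<le> sqrt (1 - curv X * (w \<bullet> w))" by simp
        then show ?thesis using cos_le_one[of "3/2 :: real"] by linarith
      qed
      then show "sheet_density X (?B r) w \<le> ennreal (1 / cos (3/2)) * indicator (ball 0 (chart_radius X r)) w"
        unfolding dens[OF r(1) r32(1)] using c by (auto simp: indicator_def intro!: ennreal_leI divide_left_mono)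
    qed
    also have "\<dots> < \<infinity>"
      using emeasure_lborel_ball_finite[of "0 :: 'v" "chart_radius X r"]
      by (simp add: nn_integral_cmult_indicator ennreal_mult_less_top)
    finally show "(\<integral>\<^sup>+w. sheet_density X (?B r) w \<partial>lborel) \<noteq> \<infinity>" by simp
    show "AE w in lborel. sheet_density X (?B r) w \<le> sheet_density X (?B s) w"
      unfolding dens[OF r(1) r32(1)] dens[OF r32(2) r(3)]
      using chart_radius_strict_mono[OF r, of X] by (auto simp: indicator_def)
    show "\<not> (AE w in lborel. sheet_density X (?B s) w \<le> sheet_density X (?B r) w)"
    proof
      assume AE: "AE w in lborel. sheet_density X (?B s) w \<le> sheet_density X (?B r) w"
      define U where "U = {w :: 'v. chart_radius X r < norm w} \<inter> {w. norm w < chart_radius X s}"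
      have "w \<notin> U" if "sheet_density X (?B s) w \<le> sheet_density X (?B r) w" for w
      proof
        assume w: "w \<in> U"
        have "curv X * (w \<bullet> w) < 1"
        proof (cases "X = Spherical")
          case True
          have "norm w < sin s" using w True by (simp add: U_def)
          then have "norm w < 1" using sin_le_one[of s] by linarith
          then have "(norm w)\<^sup>2 < 1" by (simp add: abs_square_less_1)
          then show ?thesis by (simp add: True power2_norm_eq_inner)
        next
          case False
          then have "curv X * (w \<bullet> w) \<le> 0" by (cases X) auto
          then show ?thesis by simp
        qed
        then show False using that w unfolding dens[OF r(1) r32(1)] dens[OF r32(2) r(3)]
          by (auto simp: U_def indicator_def ennreal_eq_0_iff)
      qed
      then have "AE w in lborel. w \<notin> U" using AE by (auto elim: eventually_mono)
      moreover have "open U" unfolding U_def by (intro open_Int open_Collect_less continuous_intros)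
      ultimately have "emeasure lborel U = 0"
        using AE_iff_measurable[of U lborel "\<lambda>w. w \<notin> U"] by simp
      moreover obtain e :: 'v where e: "norm e = 1" using nonempty_Basis norm_Basis by blast
      let ?m = "(chart_radius X r + chart_radius X s) / 2"
      have "0 \<le> chart_radius X r" using r pi_gt3 by (cases X) (auto intro!: sin_ge_zero)
      then have "?m *\<^sub>R e \<in> U" using e chart_radius_strict_mono[OF r, of X] by (simp add: U_def)
      then obtain d where d: "0 < d" "ball (?m *\<^sub>R e) d \<subseteq> U" using \<open>open U\<close> by (auto simp: open_contains_ball)
      have "0 < emeasure lborel (ball (?m *\<^sub>R e) d)"
        using d by (simp add: emeasure_ball ennreal_zero_less_mult_iff unit_ball_vol_pos)
      also have "\<dots> \<le> emeasure lborel U" using d \<open>open U\<close> by (intro emeasure_mono) auto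
      ultimately show False by simp
    qed
  qed
  then show ?thesis using vol[OF r(1) r32(1)] vol[OF r32(2) r(3)] by simp
qed

lemma ball_rearr_gball:
  fixes a :: "real \<times> 'v::euclidean_space"
  assumes a: "a \<in> model X" and r: "0 \<le> r" "r \<le> 1"
  shows "ball_rearr X (gball X a r) = gball X origin r"
proof
  let ?o = "origin :: real \<times> 'v"
  show "gball X ?o r \<subseteq> ball_rearr X (gball X a r)"
    unfolding ball_rearr_def
    by (intro Union_upper CollectI exI[of _ r]) (simp add: gvolume_gball[OF a] r(1))
  show "ball_rearr X (gball X a r) \<subseteq> gball X ?o r"
  proof
    fix x assume "x \<in> ball_rearr X (gball X a r)"
    then obtain B where "x \<in> B" "\<exists>q\<ge>0. B = gball X ?o q \<and> gvolume B = gvolume (gball X a r)"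
      unfolding ball_rearr_def by (elim UnionE CollectE)
    then obtain q where q: "0 \<le> q" "gvolume (gball X ?o q) = gvolume (gball X a r)" "x \<in> gball X ?o q"
      by auto
    have "q \<le> r"
    proof (rule ccontr)
      assume "\<not> q \<le> r"
      \<comment> \<open>The cap keeps the comparison ball within the range of strict monotonicity,
        however large q is.\<close>
      then have "r < min q (3/2)" using r by simp
      then have "gvolume (gball X ?o r) < gvolume (gball X ?o (min q (3/2)))"
        by (rule gvolume_gball_strict_mono[OF r(1)]) simp
      then have "gvolume (gball X a r) < gvolume (gball X ?o (min q (3/2)))"
        unfolding gvolume_gball[OF a] .
      also have "\<dots> \<le> gvolume (gball X ?o q)"
        by (rule gvolume_mono[OF _ gball_subset_model]) (auto simp: gball_def)
      finally show False using q(2) by simp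
    qed
    then show "x \<in> gball X ?o r" using q(3) by (auto simp: gball_def)
  qed
qed

text \<open>For t at least 1 both sides are empty; the maximum only keeps the radius nonnegative, as
  \<open>ball_rearr_gball\<close> requires.\<close>

lemma superlevel_tent:
  assumes "a \<in> model X" "0 < t"
  shows "{x \<in> model X. tent X a x > t} = gball X a (max 0 (1 - t))"
proof -
  have "t < tent X a x \<longleftrightarrow> gdist X x a < max 0 (1 - t)" if "x \<in> model X" for x
    using gdist_nonneg[OF that assms(1)] assms(2) by (auto simp: tent_def less_max_iff_disj)
  then show ?thesis unfolding gball_def by blast
qed

lemma is_sym_decr_rearr_tent:
  fixes a :: "real \<times> 'v::euclidean_space"
  assumes a: "a \<in> model X"
  shows "is_sym_decr_rearr X (tent X a) (tent X origin)"
  unfolding is_sym_decr_rearr_def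
proof (intro conjI ballI allI impI)
  let ?T = "tent X (origin :: real \<times> 'v)"
  show "0 \<le> ?T x" for x by (simp add: tent_def)
  have "continuous_on (model X) ?T"
    unfolding tent_def by (intro continuous_intros continuous_on_gdist origin_in_model)
  then have "openin (top_of_set (model X)) (model X \<inter> ?T -` {s<..})" for s
    by (rule continuous_openin_preimage_gen) simp
  moreover have "{x \<in> model X. s < ?T x} = model X \<inter> ?T -` {s<..}" for s
    by auto
  ultimately show "openin (top_of_set (model X)) {x \<in> model X. s < ?T x}" for s
    by simp
  show "?T y \<le> ?T x" if "gdist X x origin \<le> gdist X y origin" for x y
    using that by (simp add: tent_def)
  show "{x \<in> model X. t < ?T x} = ball_rearr X {x \<in> model X. t < tent X a x}" if "0 < t" for t
    unfolding superlevel_tent[OF a that] superlevel_tent[OF origin_in_model that]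
    using that by (intro ball_rearr_gball[OF a, symmetric]) auto
qed

text \<open>If two candidates differed at x, a level halfway between the two values would be
  positive by nonnegativity and would have different superlevel sets.\<close>

lemma is_sym_decr_rearr_unique:
  assumes g: "is_sym_decr_rearr X f g" and h: "is_sym_decr_rearr X f h" and x: "x \<in> model X"
  shows "g x = h x"
proof -
  have superlevel: "{y \<in> model X. u y > t} = ball_rearr X {y \<in> model X. f y > t}"
    if "is_sym_decr_rearr X f u" "0 < t" for u t
    using that(1)[unfolded is_sym_decr_rearr_def, THEN conjunct2, THEN conjunct2, THEN conjunct2,
        rule_format, OF that(2)] .
  have "u x \<le> w x" if u: "is_sym_decr_rearr X f u" and w: "is_sym_decr_rearr X f w" for u w
  proof (rule ccontr)
    assume less: "\<not> u x \<le> w x"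
    define t where "t = (u x + w x) / 2"
    have "0 \<le> w x" by (rule w[unfolded is_sym_decr_rearr_def, THEN conjunct1, rule_format, OF x])
    then have t: "0 < t" "w x < t" "t < u x" using less by (auto simp: t_def)
    have "{y \<in> model X. u y > t} = {y \<in> model X. w y > t}"
      unfolding superlevel[OF u t(1)] superlevel[OF w t(1)] ..
    moreover have "x \<in> {y \<in> model X. u y > t}" using x t by simp
    ultimately have "x \<in> {y \<in> model X. w y > t}" by simp
    then show False using t by simp
  qed
  then show ?thesis using g h by (simp add: order_antisym)
qed

lemma sym_decr_rearr_tent:
  assumes a: "a \<in> model X" and x: "x \<in> model X"
  shows "sym_decr_rearr X (tent X a) x = tent X origin x"
  unfolding sym_decr_rearr_def
  using is_sym_decr_rearr_unique[OF someI[of "is_sym_decr_rearr X (tent X a)", OF is_sym_decr_rearr_tent[OF a]]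
      is_sym_decr_rearr_tent[OF a] x] .

subsection \<open>Random polarizations\<close>

lemma borel_measurable_bil [measurable]:
  fixes f g :: "'w \<Rightarrow> real \<times> 'v::euclidean_space"
  assumes f: "f \<in> borel_measurable M" and g: "g \<in> borel_measurable M"
  shows "(\<lambda>\<xi>. bil X (f \<xi>) (g \<xi>)) \<in> borel_measurable M"
proof -
  have "(fst :: real \<times> 'v \<Rightarrow> real) \<in> borel_measurable borel" "(snd :: real \<times> 'v \<Rightarrow> 'v) \<in> borel_measurable borel"
    by (intro borel_measurable_continuous_onI continuous_intros)+
  note [measurable] = measurable_compose[OF f this(1)] measurable_compose[OF f this(2)]
    measurable_compose[OF g this(1)] measurable_compose[OF g this(2)]
  show ?thesis unfolding bil_def by measurable
qed

lemma borel_measurable_side [measurable]: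
  assumes [measurable]: "f \<in> borel_measurable M" "g \<in> borel_measurable M"
  shows "(\<lambda>\<xi>. side X c (f \<xi>) (g \<xi>)) \<in> borel_measurable M"
  unfolding side_def by measurable

lemma borel_measurable_normal_point [measurable]:
  "normal_point X \<in> borel_measurable borel"
proof -
  have "continuous_on UNIV (\<lambda>\<omega>. normal_point X (fst \<omega>, snd \<omega>))"
  proof (cases X)
    case Spherical
    show ?thesis unfolding Spherical normal_point.simps by (intro continuous_intros)
  next
    case Euclidean
    show ?thesis unfolding Euclidean normal_point.simps by (intro continuous_intros)
  next
    case Hyperbolic
    show ?thesis unfolding Hyperbolic normal_point.simps by (intro continuous_intros)
  qed
  then show ?thesis by (intro borel_measurable_continuous_onI) simp
qed

lemma borel_measurable_move:
  assumes [measurable]: "f \<in> borel_measurable M" "g \<in> borel_measurable M"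
  shows "(\<lambda>\<xi>. move X (f \<xi>) (g \<xi>)) \<in> borel_measurable M"
  unfolding move_def reflect_def by measurable

lemma borel_measurable_moves:
  assumes "\<And>i. i \<ge> 1 \<Longrightarrow> W i \<in> borel_measurable M"
  shows "(\<lambda>\<xi>. moves X (\<lambda>i. W i \<xi>) a n) \<in> borel_measurable M"
proof (induction n)
  case (Suc n)
  show ?case using borel_measurable_move[OF assms[of "Suc n"] Suc] by simp
qed simp

lemma moves_stay:
  assumes "\<And>i. i \<in> {1..n} \<Longrightarrow> side X origin (normal_point X (\<omega> i)) a \<le> 0"
  shows "moves X \<omega> a n = a"
  using assms by (induction n) (simp_all add: move_def)

text \<open>The events that W moves a and that its mirrored version moves a are equally likely by
  symmetry. They are disjoint, since the two normal points have opposite spatial parts and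
  \<open>side_pos_imp_inner_pos\<close> would make both inner products with a positive.\<close>

lemma (in prob_space) prob_stay_ge_half:
  fixes W :: "'a \<Rightarrow> real \<times> 'v::euclidean_space"
  assumes a: "a \<in> model X" "0 \<le> fst a"
    and W: "random_variable (restrict_space borel Omega) W"
    and sym: "distr M (restrict_space borel Omega) W =
      distr M (restrict_space borel Omega) (\<lambda>\<xi>. (fst (W \<xi>), - snd (W \<xi>)))"
  shows "1 / 2 \<le> prob {\<xi> \<in> space M. side X origin (normal_point X (W \<xi>)) a \<le> 0}"
proof -
  let ?N = "restrict_space borel (Omega :: (real \<times> 'v) set)"
  let ?W' = "\<lambda>\<xi>. (fst (W \<xi>), - snd (W \<xi>))"
  have W_Omega: "W \<xi> \<in> Omega" if "\<xi> \<in> space M" for \<xi>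
    using measurable_space[OF W that] by (simp add: space_restrict_space)
  have Wb: "W \<in> borel_measurable M" using W by (simp add: measurable_restrict_space2_iff)
  have "(\<lambda>\<omega>. (fst \<omega>, - snd \<omega>)) \<in> borel_measurable (borel :: (real \<times> 'v) measure)"
    by (intro borel_measurable_continuous_onI continuous_intros)
  moreover have "?W' \<xi> \<in> Omega" if "\<xi> \<in> space M" for \<xi>
    using W_Omega[OF that] by (simp add: Omega_def mem_Times_iff)
  ultimately have W': "random_variable ?N ?W'"
    using measurable_compose[OF Wb] by (auto simp: measurable_restrict_space2_iff)
  define D where "D = {\<omega> \<in> space ?N. 0 < side X origin (normal_point X \<omega>) a}"
  have "{\<omega> \<in> space borel. 0 < side X origin (normal_point X \<omega>) a} \<in> sets borel" by measurable
  then have D: "D \<in> sets ?N"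
    by (auto simp: D_def sets_restrict_space space_restrict_space)
  have "prob (W -` D \<inter> space M) = measure (distr M ?N W) D" by (rule measure_distr[OF W D, symmetric])
  also have "\<dots> = prob (?W' -` D \<inter> space M)" unfolding sym by (rule measure_distr[OF W' D])
  finally have eq: "prob (W -` D \<inter> space M) = prob (?W' -` D \<inter> space M)" .
  have "W -` D \<inter> space M \<inter> (?W' -` D \<inter> space M) = {}"
  proof -
    have "\<not> (W \<xi> \<in> D \<and> ?W' \<xi> \<in> D)" for \<xi>
    proof
      assume *: "W \<xi> \<in> D \<and> ?W' \<xi> \<in> D"
      then have n: "norm (snd (W \<xi>)) = 1" "norm (snd (?W' \<xi>)) = 1"
        by (auto simp: D_def space_restrict_space Omega_def)
      have "0 < snd (normal_point X (W \<xi>)) \<bullet> snd a" "0 < snd (normal_point X (?W' \<xi>)) \<bullet> snd a"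
        using * by (auto intro!: side_pos_imp_inner_pos[OF normal_point_in_model[OF n(1)] a]
            side_pos_imp_inner_pos[OF normal_point_in_model[OF n(2)] a] simp: D_def)
      moreover have "snd (normal_point X (?W' \<xi>)) = - snd (normal_point X (W \<xi>))"
        by (cases "W \<xi>"; cases X) simp_all
      ultimately show False by simp
    qed
    then show ?thesis by blast
  qed
  moreover have sets: "W -` D \<inter> space M \<in> events" "?W' -` D \<inter> space M \<in> events"
    using measurable_sets[OF W D] measurable_sets[OF W' D] by auto
  ultimately have "prob (W -` D \<inter> space M) + prob (?W' -` D \<inter> space M)
      = prob (W -` D \<inter> space M \<union> ?W' -` D \<inter> space M)"
    by (simp add: finite_measure_Union)
  also have "\<dots> \<le> 1" by (rule prob_le_1)
  finally have "prob (W -` D \<inter> space M) \<le> 1 / 2" using eq by simp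
  moreover have "{\<xi> \<in> space M. side X origin (normal_point X (W \<xi>)) a \<le> 0} = space M - (W -` D \<inter> space M)"
    using W_Omega by (auto simp: D_def space_restrict_space)
  ultimately show ?thesis using prob_compl[OF sets(1)] by simp
qed

text \<open>The event E that none of the n reflections moves the initial point a is an intersection
  of independent events of probability at least 1/2. On E the point is still at a after n steps;
  elsewhere the distance is at least 0.\<close>

lemma (in prob_space) expectation_gdist_moves_ge:
  fixes W :: "nat \<Rightarrow> 'a \<Rightarrow> real \<times> 'v::euclidean_space"
  assumes a: "a \<in> model X" "gdist X a origin \<le> 1" and n: "1 \<le> n"
    and indep: "indep_vars (\<lambda>_. restrict_space borel Omega) W {1..}"
    and sym: "\<And>i. 1 \<le> i \<Longrightarrow> distr M (restrict_space borel Omega) (W i) =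
      distr M (restrict_space borel Omega) (\<lambda>\<xi>. (fst (W i \<xi>), - snd (W i \<xi>)))"
  shows "gdist X a origin * (1 / 2) ^ n \<le> expectation (\<lambda>\<xi>. gdist X (moves X (\<lambda>i. W i \<xi>) a n) origin)"
proof -
  let ?N = "restrict_space borel (Omega :: (real \<times> 'v) set)"
  have W: "random_variable ?N (W i)" if "1 \<le> i" for i
    using indep that by (auto simp: indep_vars_def)
  have Wb: "W i \<in> borel_measurable M" if "1 \<le> i" for i
    using W[OF that] by (simp add: measurable_restrict_space2_iff)
  have W1: "norm (snd (W i \<xi>)) = 1" if "\<xi> \<in> space M" "1 \<le> i" for i \<xi>
    using measurable_space[OF W[OF that(2)] that(1)] by (auto simp: space_restrict_space Omega_def)
  obtain u where u: "norm u = 1" "a = normal_point X (gdist X a origin, u)"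
    using normal_point_exists[OF a(1)] by blast
  have d0: "0 \<le> gdist X a origin" by (rule gdist_nonneg[OF a(1) origin_in_model])
  have fst_a: "0 \<le> fst a" using normal_point_small(1)[OF u(1), of "gdist X a origin" X] u(2) a(2) d0 by simp
  define S where "S = {\<omega> \<in> space ?N. side X origin (normal_point X \<omega>) a \<le> 0}"
  have "{\<omega> \<in> space borel. side X origin (normal_point X \<omega>) a \<le> 0} \<in> sets borel" by measurable
  then have S: "S \<in> sets ?N"
    by (auto simp: S_def sets_restrict_space space_restrict_space)
  have pre: "W i -` S \<inter> space M = {\<xi> \<in> space M. side X origin (normal_point X (W i \<xi>)) a \<le> 0}" if "1 \<le> i" for i
    using measurable_space[OF W[OF that]] by (auto simp: S_def)
  define E where "E = (\<Inter>i\<in>{1..n}. W i -` S \<inter> space M)"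
  have E: "E \<in> events" unfolding E_def
    using n measurable_sets[OF W S] by (intro sets.finite_INT) auto
  have "(1 / 2) ^ n = (\<Prod>i\<in>{1..n}. 1 / 2 :: real)" by simp
  also have "\<dots> \<le> (\<Prod>i\<in>{1..n}. prob (W i -` S \<inter> space M))"
    using prob_stay_ge_half[OF a(1) fst_a W sym] by (intro prod_mono) (auto simp: pre)
  also have "\<dots> = prob E" unfolding E_def
    using n S by (intro indep_varsD[OF indep, symmetric]) auto
  finally have prob_E: "(1 / 2) ^ n \<le> prob E" .
  let ?A = "\<lambda>\<xi>. moves X (\<lambda>i. W i \<xi>) a n"
  have A_model: "?A \<xi> \<in> model X" if "\<xi> \<in> space M" for \<xi>
    using W1[OF that] a(1) by (rule moves_in_model)
  have A_le: "gdist X (?A \<xi>) origin \<le> gdist X a origin" if "\<xi> \<in> space M" for \<xi>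
    using W1[OF that] a(1) by (rule gdist_moves_le)
  \<comment> \<open>Measurability is essential here, since the expectation of a non-integrable
    function is 0. The target is restricted to the model because \<open>gdist\<close> is continuous
    only there.\<close>
  have "?A \<in> M \<rightarrow>\<^sub>M restrict_space borel (model X)"
    using borel_measurable_moves[OF Wb] A_model by (auto simp: measurable_restrict_space2_iff)
  moreover have "(\<lambda>x. gdist X x origin) \<in> borel_measurable (restrict_space borel (model X :: (real \<times> 'v) set))"
    by (intro borel_measurable_continuous_on_restrict continuous_on_gdist origin_in_model)
  ultimately have meas: "(\<lambda>\<xi>. gdist X (?A \<xi>) origin) \<in> borel_measurable M"
    by (rule measurable_compose)
  have "gdist X a origin * (1 / 2) ^ n \<le> gdist X a origin * prob E"
    using prob_E d0 by (rule mult_left_mono)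
  also have "\<dots> = expectation (\<lambda>\<xi>. gdist X a origin * indicator E \<xi>)"
    using E by simp
  also have "\<dots> \<le> expectation (\<lambda>\<xi>. gdist X (?A \<xi>) origin)"
  proof (rule integral_mono)
    show "integrable M (\<lambda>\<xi>. gdist X a origin * indicator E \<xi>)"
      using E by (intro integrable_mult_right integrable_real_indicator) (auto simp: less_top[symmetric])
    show "integrable M (\<lambda>\<xi>. gdist X (?A \<xi>) origin)"
      using A_le gdist_nonneg[OF A_model origin_in_model]
      by (intro integrable_const_bound[where B = "gdist X a origin"] AE_I2 meas) simp
    fix \<xi> assume \<xi>: "\<xi> \<in> space M"
    show "gdist X a origin * indicator E \<xi> \<le> gdist X (?A \<xi>) origin"
    proof (cases "\<xi> \<in> E")
      case True
      have "side X origin (normal_point X (W i \<xi>)) a \<le> 0" if "i \<in> {1..n}" for i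
        using True that pre[of i] unfolding E_def by auto
      then have "?A \<xi> = a" by (rule moves_stay)
      then show ?thesis using True by simp
    next
      case False
      then show ?thesis using gdist_nonneg[OF A_model[OF \<xi>] origin_in_model] by simp
    qed
  qed
  finally show ?thesis .
qed

theorem proposition6p1:
  fixes X :: geometry
    and a :: "real \<times> 'v::euclidean_space"
    and f :: "real \<times> 'v \<Rightarrow> real"
  assumes a: "a \<in> model X"
    and f: "f = (\<lambda>x. max (1 - gdist X x a) 0)"
  shows
    "(gdist X a origin \<le> 1 \<longrightarrow>
       (\<forall>(M :: 'w measure) (W :: nat \<Rightarrow> 'w \<Rightarrow> real \<times> 'v) n.
          prob_space M \<and>
          prob_space.indep_vars M (\<lambda>_. restrict_space borel Omega) W {1..} \<and>
          (\<forall>i\<ge>1. AE \<xi> in M. fst (W i \<xi>) \<noteq> 0) \<and>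
          (X = Spherical \<longrightarrow> (\<forall>i\<ge>1. AE \<xi> in M. fst (W i \<xi>) \<le> pi)) \<and>
          (\<forall>i\<ge>1. distr M (restrict_space borel Omega) (W i) =
                  distr M (restrict_space borel Omega) (\<lambda>\<xi>. (fst (W i \<xi>), - snd (W i \<xi>)))) \<and>
          n \<ge> 1 \<longrightarrow>
          prob_space.expectation M
            (\<lambda>\<xi>. sup_norm X
               (\<lambda>x. polarizations X (\<lambda>i. W i \<xi>) n f x - sym_decr_rearr X f x))
          \<ge> sup_norm X (\<lambda>x. f x - sym_decr_rearr X f x) * (1 / 2) ^ n)) \<and>
     (a \<noteq> origin \<longrightarrow>
       (\<exists>\<omega> :: nat \<Rightarrow> real \<times> 'v.
          (\<forall>i\<ge>1. \<omega> i \<in> Omega_used X \<and> fst (\<omega> i) > 0) \<and>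
          Omega_used X \<subseteq> closure (\<omega> ` {1..}) \<and>
          \<not> (\<exists>g \<in> Cc_plus X.
                uniform_limit (model X) (\<lambda>n. polarizations X \<omega> n f) g sequentially)))"
proof -
  have f_tent: "f = tent X a" by (simp add: f tent_def fun_eq_iff)
  \<comment> \<open>Used for the initial centre and for the moved one; the bound by 1 persists
    because a move never increases the distance from \<open>o\<close>.\<close>
  have sup_norm_eq: "sup_norm X (\<lambda>x. g x - sym_decr_rearr X f x) = gdist X b origin"
    if "b \<in> model X" "gdist X b origin \<le> 1" "\<And>x. x \<in> model X \<Longrightarrow> g x = tent X b x" for g b
  proof -
    have "sup_norm X (\<lambda>x. g x - sym_decr_rearr X f x) = sup_norm X (\<lambda>x. tent X b x - tent X origin x)"
      unfolding f_tent by (rule sup_norm_cong) (simp add: that(3) sym_decr_rearr_tent[OF a])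
    then show ?thesis using sup_norm_tent_diff[OF that(1,2)] by simp
  qed
  show ?thesis
  proof (intro conjI impI allI, elim conjE)
    fix M :: "'w measure" and W :: "nat \<Rightarrow> 'w \<Rightarrow> real \<times> 'v" and n :: nat
    assume le: "gdist X a origin \<le> 1" and M: "prob_space M"
      and indep: "prob_space.indep_vars M (\<lambda>_. restrict_space borel Omega) W {1..}"
      and sym: "\<forall>i\<ge>1. distr M (restrict_space borel Omega) (W i) =
                  distr M (restrict_space borel Omega) (\<lambda>\<xi>. (fst (W i \<xi>), - snd (W i \<xi>)))"
      and n: "1 \<le> n"
    interpret prob_space M by fact
    have W: "norm (snd (W i \<xi>)) = 1" if "\<xi> \<in> space M" "1 \<le> i" for i \<xi>
    proof -
      have "random_variable (restrict_space borel Omega) (W i)"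
        using indep that(2) by (auto simp: indep_vars_def)
      from measurable_space[OF this that(1)] show ?thesis
        by (auto simp: space_restrict_space Omega_def)
    qed
    have "sup_norm X (\<lambda>x. polarizations X (\<lambda>i. W i \<xi>) n f x - sym_decr_rearr X f x)
        = gdist X (moves X (\<lambda>i. W i \<xi>) a n) origin" if \<xi>: "\<xi> \<in> space M" for \<xi>
    proof (rule sup_norm_eq)
      show "moves X (\<lambda>i. W i \<xi>) a n \<in> model X" using W[OF \<xi>] a by (rule moves_in_model)
      show "gdist X (moves X (\<lambda>i. W i \<xi>) a n) origin \<le> 1"
        using gdist_moves_le[OF W[OF \<xi>] a] le by (rule order_trans)
      show "polarizations X (\<lambda>i. W i \<xi>) n f x = tent X (moves X (\<lambda>i. W i \<xi>) a n) x" if "x \<in> model X" for x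
        unfolding f_tent using W[OF \<xi>] a that by (rule polarizations_tent)
    qed
    then have "expectation (\<lambda>\<xi>. sup_norm X (\<lambda>x. polarizations X (\<lambda>i. W i \<xi>) n f x - sym_decr_rearr X f x))
        = expectation (\<lambda>\<xi>. gdist X (moves X (\<lambda>i. W i \<xi>) a n) origin)"
      by (rule Bochner_Integration.integral_cong[OF refl])
    moreover have "sup_norm X (\<lambda>x. f x - sym_decr_rearr X f x) = gdist X a origin"
      by (rule sup_norm_eq[OF a le]) (simp add: f_tent)
    ultimately show "sup_norm X (\<lambda>x. f x - sym_decr_rearr X f x) * (1 / 2) ^ n
        \<le> expectation (\<lambda>\<xi>. sup_norm X (\<lambda>x. polarizations X (\<lambda>i. W i \<xi>) n f x - sym_decr_rearr X f x))"
      using expectation_gdist_moves_ge[OF a le n indep] sym by simp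
  next
    assume "a \<noteq> origin"
    then obtain \<omega> x where \<omega>: "\<And>i. i \<ge> 1 \<Longrightarrow> \<omega> i \<in> Omega_used X \<and> fst (\<omega> i) > 0"
        "Omega_used X \<subseteq> closure (\<omega> ` {1..})" "x \<in> model X"
        "\<not> convergent (\<lambda>n. polarizations X \<omega> n (tent X a) x)"
      using exists_dense_divergent_polarizations[OF a] by metis
    \<comment> \<open>Uniform convergence would entail convergence at the single point x, so every
      limit function g is excluded, whether or not it lies in \<open>Cc_plus X\<close>.\<close>
    have "\<not> uniform_limit (model X) (\<lambda>n. polarizations X \<omega> n f) g sequentially" for g
      using tendsto_uniform_limitI[OF _ \<omega>(3)] \<omega>(4) unfolding f_tent convergent_def by blast
    then show "\<exists>\<omega> :: nat \<Rightarrow> real \<times> 'v.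
          (\<forall>i\<ge>1. \<omega> i \<in> Omega_used X \<and> fst (\<omega> i) > 0) \<and>
          Omega_used X \<subseteq> closure (\<omega> ` {1..}) \<and>
          \<not> (\<exists>g \<in> Cc_plus X.
                uniform_limit (model X) (\<lambda>n. polarizations X \<omega> n f) g sequentially)"
      using \<omega>(1,2) by blast
  qed
qed

end
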